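(* Let $\mathcal{G}=(G,\lambda)$ be a temporal graph with lifetime $\tau$, and let $w$ be the width of a (nice) tree decomposition of the underlying graph $G$ that is available to the algorithm. Then the minimum cardinality of a temporal edge cover of $\mathcal{G}$ can be computed in time $O^*(2^{w^2}\cdot 8^{w\cdot\tau})$, where $O^*$ suppresses factors polynomial in the input size.
   Context: A temporal graph with lifetime $\tau$ is a pair $\mathcal{G}=(G,\lambda)$ where $G$ is a finite simple undirected graph and $\lambda$ assigns to each edge $e\in E(G)$ a non-empty subset $\lambda(e)\subseteq\{1,\dots,\tau\}$. A temporal vertex $(v,t)\in V(G)\times\{1,\dots,\tau\}$ is isolated if $t\notin\lambda(uv)$ for every neighbour $u$ of $v$. A temporal edge cover of $\mathcal{G}$ is a set $S\subseteq E(G)$ such that for every non-isolated temporal vertex $(v,t)$ there is an edge $e\in S$ incident to $v$ with $t\in\lambda(e)$. *)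

theory Defs
  imports Main "HOL-Computational_Algebra.Polynomial"
begin

section \<open>Temporal graphs and temporal edge covers\<close>

definition simple_graph :: "'a set \<Rightarrow> 'a set set \<Rightarrow> bool" where
  "simple_graph V E \<longleftrightarrow> finite V \<and> (\<forall>e\<in>E. e \<subseteq> V \<and> card e = 2)"

text \<open>Only the values of \<open>lam\<close> on the edges in \<open>E\<close> are ever consulted.\<close>

definition temporal_graph :: "'a set \<Rightarrow> 'a set set \<Rightarrow> ('a set \<Rightarrow> nat set) \<Rightarrow> nat \<Rightarrow> bool" where
  "temporal_graph V E lam \<tau> \<longleftrightarrow>
     simple_graph V E \<and> (\<forall>e\<in>E. lam e \<noteq> {} \<and> lam e \<subseteq> {1..\<tau>})"

definition isolated :: "'a set set \<Rightarrow> ('a set \<Rightarrow> nat set) \<Rightarrow> 'a \<Rightarrow> nat \<Rightarrow> bool" where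
  "isolated E lam v t \<longleftrightarrow> (\<forall>u. {u, v} \<in> E \<longrightarrow> t \<notin> lam {u, v})"

definition temporal_edge_cover ::
  "'a set \<Rightarrow> 'a set set \<Rightarrow> ('a set \<Rightarrow> nat set) \<Rightarrow> nat \<Rightarrow> 'a set set \<Rightarrow> bool" where
  "temporal_edge_cover V E lam \<tau> S \<longleftrightarrow>
     S \<subseteq> E \<and> (\<forall>v\<in>V. \<forall>t\<in>{1..\<tau>}. \<not> isolated E lam v t \<longrightarrow> (\<exists>e\<in>S. v \<in> e \<and> t \<in> lam e))"

definition min_temporal_edge_cover ::
  "'a set \<Rightarrow> 'a set set \<Rightarrow> ('a set \<Rightarrow> nat set) \<Rightarrow> nat \<Rightarrow> nat" where
  "min_temporal_edge_cover V E lam \<tau> =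
     (LEAST k. \<exists>S. temporal_edge_cover V E lam \<tau> S \<and> card S = k)"


section \<open>Tree decompositions\<close>

text \<open>\<open>connected_on J F\<close>: the subgraph induced by the vertex set \<open>J\<close> is connected.\<close>

definition connected_on :: "'i set \<Rightarrow> 'i set set \<Rightarrow> bool" where
  "connected_on J F \<longleftrightarrow>
     (\<forall>x\<in>J. \<forall>y\<in>J. (x, y) \<in> {(a, b). a \<in> J \<and> b \<in> J \<and> {a, b} \<in> F}\<^sup>*)"

definition is_cycle :: "'i set set \<Rightarrow> 'i list \<Rightarrow> bool" where
  "is_cycle F xs \<longleftrightarrow> length xs \<ge> 3 \<and> distinct xs \<and>
     (\<forall>i<length xs. {xs ! i, xs ! (Suc i mod length xs)} \<in> F)"

definition is_tree :: "'i set \<Rightarrow> 'i set set \<Rightarrow> bool" where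
  "is_tree I F \<longleftrightarrow> simple_graph I F \<and> I \<noteq> {} \<and> connected_on I F \<and> \<not> (\<exists>xs. is_cycle F xs)"

definition tree_decomposition ::
  "'a set \<Rightarrow> 'a set set \<Rightarrow> 'i set \<Rightarrow> 'i set set \<Rightarrow> ('i \<Rightarrow> 'a set) \<Rightarrow> bool" where
  "tree_decomposition V E I F X \<longleftrightarrow>
     is_tree I F \<and>
     (\<Union>i\<in>I. X i) = V \<and>
     (\<forall>e\<in>E. \<exists>i\<in>I. e \<subseteq> X i) \<and>
     (\<forall>v\<in>V. connected_on {i\<in>I. v \<in> X i} F)"

text \<open>Truncated subtraction: the decomposition of the empty graph into empty bags gets
  width 0 instead of -1.\<close>

definition width :: "'i set \<Rightarrow> ('i \<Rightarrow> 'a set) \<Rightarrow> nat" where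
  "width I X = Max ((\<lambda>i. card (X i)) ` I) - 1"


section \<open>Model of computation\<close>

text \<open>
  Programs are systems of first-order call-by-value recursive functions over binary trees, as in
  Jones' textbook on computability and complexity (a pure Lisp without symbols).
  A value is a pointer to an immutable cell, and every evaluated expression node costs one unit.
  Each unit is a bounded number of pointer operations, so that a random access machine simulates
  a fixed program with constant overhead per unit.  In particular there is no unit-cost
  arithmetic and no unit-cost comparison of structures.
\<close>

datatype val = Null | Cell val val

primrec val_size :: "val \<Rightarrow> nat" where
  "val_size Null = 1"
| "val_size (Cell a b) = 1 + val_size a + val_size b"

primrec val_fst :: "val \<Rightarrow> val" where
  "val_fst Null = Null"
| "val_fst (Cell a b) = a"

primrec val_snd :: "val \<Rightarrow> val" where
  "val_snd Null = Null"
| "val_snd (Cell a b) = b"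

datatype expr =
    Var nat
  | MkNull
  | MkCell expr expr
  | Fst expr
  | Snd expr
  | Cond expr expr expr
  | Call nat "expr list"

text \<open>A program lists its function bodies; \<open>Var i\<close> is the \<open>i\<close>-th argument of the enclosing
  function.\<close>

type_synonym program = "expr list"

text \<open>\<open>eval P env e v n\<close>: with arguments \<open>env\<close>, the expression \<open>e\<close> has value \<open>v\<close>, computed in
  \<open>n\<close> steps.  \<open>Null\<close> plays the role of false in conditionals.\<close>

inductive eval :: "program \<Rightarrow> val list \<Rightarrow> expr \<Rightarrow> val \<Rightarrow> nat \<Rightarrow> bool"
  and evals :: "program \<Rightarrow> val list \<Rightarrow> expr list \<Rightarrow> val list \<Rightarrow> nat \<Rightarrow> bool"
  for P :: program where
  Var: "i < length env \<Longrightarrow> eval P env (Var i) (env ! i) 1"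
| MkNull: "eval P env MkNull Null 1"
| MkCell: "eval P env a x m \<Longrightarrow> eval P env b y n \<Longrightarrow>
     eval P env (MkCell a b) (Cell x y) (m + n + 1)"
| Fst: "eval P env a x m \<Longrightarrow> eval P env (Fst a) (val_fst x) (m + 1)"
| Snd: "eval P env a x m \<Longrightarrow> eval P env (Snd a) (val_snd x) (m + 1)"
| Cond_true: "eval P env a x m \<Longrightarrow> x \<noteq> Null \<Longrightarrow> eval P env b y n \<Longrightarrow>
     eval P env (Cond a b c) y (m + n + 1)"
| Cond_false: "eval P env a Null m \<Longrightarrow> eval P env c y n \<Longrightarrow>
     eval P env (Cond a b c) y (m + n + 1)"
| Call: "evals P env as xs m \<Longrightarrow> f < length P \<Longrightarrow> eval P xs (P ! f) y n \<Longrightarrow>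
     eval P env (Call f as) y (m + n + 1)"
| Nil: "evals P env [] [] 0"
| Cons: "eval P env a x m \<Longrightarrow> evals P env as xs n \<Longrightarrow>
     evals P env (a # as) (x # xs) (m + n)"

lemma eval_deterministic:
  "eval P env e v n \<Longrightarrow> eval P env e v' n' \<Longrightarrow> v' = v \<and> n' = n"
  "evals P env es vs n \<Longrightarrow> evals P env es vs' n' \<Longrightarrow> vs' = vs \<and> n' = n"
proof (induction arbitrary: v' n' and vs' n' rule: eval_evals.inducts)
  case (Var i env)
  then show ?case by (auto elim: eval.cases)
next
  case (MkNull env)
  then show ?case by (auto elim: eval.cases)
next
  case (MkCell env a x m b y n)
  from MkCell.prems show ?case by cases (use MkCell.IH in blast)
next
  case (Fst env a x m)
  from Fst.prems show ?case by cases (use Fst.IH in blast)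
next
  case (Snd env a x m)
  from Snd.prems show ?case by cases (use Snd.IH in blast)
next
  case (Cond_true env a x m b y n c)
  from Cond_true.prems show ?case by cases (use Cond_true.IH Cond_true.hyps in blast)+
next
  case (Cond_false env a m c y n b)
  from Cond_false.prems show ?case by cases (use Cond_false.IH in blast)+
next
  case (Call env as xs m f y n)
  from Call.prems show ?case by cases (use Call.IH in blast)
next
  case (Nil env)
  then show ?case by (auto elim: evals.cases)
next
  case (Cons env a x m as xs n)
  from Cons.prems show ?case by cases (use Cons.IH in blast)
qed

text \<open>The function with index 0 is the entry point.\<close>

definition computes_in :: "program \<Rightarrow> val \<Rightarrow> val \<Rightarrow> nat \<Rightarrow> bool" where
  "computes_in P x y n \<longleftrightarrow> eval P [x] (Call 0 [Var 0]) y n"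


section \<open>Input and output format\<close>

text \<open>Numbers are written in binary, least significant bit first, without leading zeros.\<close>

fun enc_nat :: "nat \<Rightarrow> val" where
  "enc_nat n = (if n = 0 then Null
     else Cell (if even n then Null else Cell Null Null) (enc_nat (n div 2)))"

declare enc_nat.simps [simp del]

definition enc_list :: "val list \<Rightarrow> val" where
  "enc_list xs = foldr Cell xs Null"

text \<open>A finite tree with bags is written down as a rooted ordered tree (with an arbitrary choice
  of root and of the order of children); its nodes are the paths from the root.\<close>

datatype bag_tree = Node (root_bag: "nat list") (children: "bag_tree list")

primrec enc_bag_tree :: "bag_tree \<Rightarrow> val" where
  "enc_bag_tree (Node b ts) =
     Cell (enc_list (map enc_nat b)) (enc_list (map enc_bag_tree ts))"

primrec subtree_at :: "nat list \<Rightarrow> bag_tree \<Rightarrow> bag_tree option" where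
  "subtree_at [] T = Some T"
| "subtree_at (i # p) T =
     (if i < length (children T) then subtree_at p (children T ! i) else None)"

definition nodes :: "bag_tree \<Rightarrow> nat list set" where
  "nodes T = {p. subtree_at p T \<noteq> None}"

definition tree_edges :: "bag_tree \<Rightarrow> nat list set set" where
  "tree_edges T = {{p, p @ [i]} |p i. p @ [i] \<in> nodes T}"

definition bag_list :: "bag_tree \<Rightarrow> nat list \<Rightarrow> nat list" where
  "bag_list T p = root_bag (the (subtree_at p T))"

definition bag :: "bag_tree \<Rightarrow> nat list \<Rightarrow> nat set" where
  "bag T p = set (bag_list T p)"

text \<open>Finite sets are written down as lists without repetitions; an entry \<open>(u, v, ls)\<close> of the
  edge list stands for the edge \<open>{u, v}\<close> together with its label set.\<close>

definition graph_listing ::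
  "nat list \<Rightarrow> (nat \<times> nat \<times> nat list) list \<Rightarrow> nat set \<Rightarrow> nat set set \<Rightarrow> (nat set \<Rightarrow> nat set) \<Rightarrow> bool"
where
  "graph_listing vs es V E lam \<longleftrightarrow>
     distinct vs \<and> set vs = V \<and>
     distinct (map (\<lambda>(u, v, ls). {u, v}) es) \<and> set (map (\<lambda>(u, v, ls). {u, v}) es) = E \<and>
     (\<forall>(u, v, ls)\<in>set es. distinct ls \<and> set ls = lam {u, v})"

definition enc_instance ::
  "nat list \<Rightarrow> (nat \<times> nat \<times> nat list) list \<Rightarrow> nat \<Rightarrow> bag_tree \<Rightarrow> val" where
  "enc_instance vs es \<tau> T =
     Cell (enc_list (map enc_nat vs))
       (Cell (enc_list (map (\<lambda>(u, v, ls).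
                 Cell (enc_nat u) (Cell (enc_nat v) (enc_list (map enc_nat ls)))) es))
         (Cell (enc_nat \<tau>) (enc_bag_tree T)))"

end

theory Submission imports Defs begin

text \<open>
  Call a pair \<open>(v, t)\<close> that is not isolated a slot; an edge covers the slots given by its
  endpoints and labels, so the problem is a set cover problem.  It becomes total by letting an
  uncovered slot cost 1: as each slot lies in some edge, the optimum does not change, and partial
  solutions need no value for infeasibility.

  For a bag \<open>X\<close> the program keeps the table which maps a demand \<open>D\<close>, a set of slots of \<open>X\<close>, to the
  optimum for \<open>D\<close> together with all slots that occur only below \<open>X\<close>, using the edges below \<open>X\<close>.
  Each edge is used at the topmost bag that contains it, which costs one pass over the table, so
  the edges inside a bag are never guessed.  A child is joined to its parent by distributing the
  demand on the common slots.  A child whose slots all occur in the parent is skipped, and its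
  children are attached to the parent; hence every join has at most \<open>(w + 1) \<tau>\<close> slots in the parent
  and at most \<open>w \<tau>\<close> common slots, and since each common slot goes one of three ways, its cost is
  within \<open>2 ^ ((2 w + 1) \<tau>) \<le> 8 ^ (w \<tau>)\<close> up to polynomial factors.  (If \<open>w = 0\<close>, there
  are no edges and hence no slots.)
\<close>

section \<open>The program\<close>

text \<open>The machine has neither arithmetic nor indexing. Hence a table is a binary tree with one
  level per slot and unary numbers at its leaves, and every table operation is a recursion along the
  slot list. Unary sums and minima are affordable because all values are at most the number of
  slots. Such recursions fix the order of the slots: a bag first lists those that the outer bag
  lacks, so that demanding all of them means following one path, and then the shared ones in the
  order of the outer bag, so that both tables can be walked together in a join.

  Skipping is what the base 8 requires. For \<open>w = 1\<close>, a child that shares all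
  \<open>2 * \<tau>\<close> slots with its parent would cost \<open>9 ^ \<tau>\<close> by the
  three-way choice, more than \<open>8 ^ \<tau>\<close>. Without such children the exponent is
  governed by \<open>2 * w + 1 \<le> 3 * w\<close>, which is an equality at
  \<open>w = 1\<close>.\<close>

definition MAIN :: nat where "MAIN = 0"
definition EQ :: nat where "EQ = 1"
definition MEM :: nat where "MEM = 2"
definition SUBSET :: nat where "SUBSET = 3"
definition APPEND :: nat where "APPEND = 4"
definition OUTSIDE :: nat where "OUTSIDE = 5"
definition SLOTS :: nat where "SLOTS = 6"
definition PAIRS :: nat where "PAIRS = 7"
definition COV :: nat where "COV = 8"
definition UNIVERSE :: nat where "UNIVERSE = 9"
definition MINIMUM :: nat where "MINIMUM = 10"
definition BASE :: nat where "BASE = 11"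
definition POINTMIN :: nat where "POINTMIN = 12"
definition ADDSET :: nat where "ADDSET = 13"
definition ADDSETS :: nat where "ADDSETS = 14"
definition JOIN :: nat where "JOIN = 15"
definition DOWN :: nat where "DOWN = 16"
definition PROC :: nat where "PROC = 17"
definition PROCNEW :: nat where "PROCNEW = 18"
definition FOLD :: nat where "FOLD = 19"
definition INCR :: nat where "INCR = 20"
definition TOBIN :: nat where "TOBIN = 21"

lemmas index_defs = MAIN_def EQ_def MEM_def SUBSET_def APPEND_def OUTSIDE_def SLOTS_def PAIRS_def
  COV_def UNIVERSE_def MINIMUM_def BASE_def POINTMIN_def ADDSET_def ADDSETS_def JOIN_def DOWN_def
  PROC_def PROCNEW_def FOLD_def INCR_def TOBIN_def

abbreviation MkTrue :: expr where "MkTrue \<equiv> MkCell MkNull MkNull"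

definition MAIN_body :: expr where \<comment> \<open>arguments: instance\<close>
  "MAIN_body =
    Call TOBIN [Call PROC [Snd (Snd (Snd (Var 0))), Fst (Snd (Var 0)),
      Call UNIVERSE [Fst (Snd (Var 0)), MkNull], MkNull, MkNull]]"

definition EQ_body :: expr where \<comment> \<open>arguments: x, y\<close>
  "EQ_body =
    Cond (Var 0)
      (Cond (Var 1)
        (Cond (Call EQ [Fst (Var 0), Fst (Var 1)]) (Call EQ [Snd (Var 0), Snd (Var 1)]) MkNull)
        MkNull)
      (Cond (Var 1) MkNull MkTrue)"

definition MEM_body :: expr where \<comment> \<open>arguments: x, ys\<close>
  "MEM_body =
    Cond (Var 1)
      (Cond (Call EQ [Var 0, Fst (Var 1)]) MkTrue (Call MEM [Var 0, Snd (Var 1)]))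
      MkNull"

definition SUBSET_body :: expr where \<comment> \<open>arguments: xs, ys\<close>
  "SUBSET_body =
    Cond (Var 0)
      (Cond (Call MEM [Fst (Var 0), Var 1]) (Call SUBSET [Snd (Var 0), Var 1]) MkNull)
      MkTrue"

definition APPEND_body :: expr where \<comment> \<open>arguments: xs, ys\<close>
  "APPEND_body =
    Cond (Var 0) (MkCell (Fst (Var 0)) (Call APPEND [Snd (Var 0), Var 1])) (Var 1)"

definition OUTSIDE_body :: expr where \<comment> \<open>arguments: xs, ys\<close>
  "OUTSIDE_body =
    Cond (Var 0)
      (Cond (Call MEM [Fst (Var 0), Var 1])
        (Call OUTSIDE [Snd (Var 0), Var 1])
        (MkCell (Fst (Var 0)) (Call OUTSIDE [Snd (Var 0), Var 1])))
      MkNull"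

definition SLOTS_body :: expr where \<comment> \<open>arguments: slots, bag\<close>
  "SLOTS_body =
    Cond (Var 0)
      (Cond (Call MEM [Fst (Fst (Var 0)), Var 1])
        (MkCell (Fst (Var 0)) (Call SLOTS [Snd (Var 0), Var 1]))
        (Call SLOTS [Snd (Var 0), Var 1]))
      MkNull"

definition PAIRS_body :: expr where \<comment> \<open>arguments: x, ys\<close>
  "PAIRS_body =
    Cond (Var 1)
      (MkCell (MkCell (Var 0) (Fst (Var 1))) (Call PAIRS [Var 0, Snd (Var 1)]))
      MkNull"

definition COV_body :: expr where \<comment> \<open>arguments: edge\<close>
  "COV_body =
    Call APPEND [Call PAIRS [Fst (Var 0), Snd (Snd (Var 0))],
      Call PAIRS [Fst (Snd (Var 0)), Snd (Snd (Var 0))]]"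

definition UNIVERSE_body :: expr where \<comment> \<open>arguments: edges, slots\<close>
  "UNIVERSE_body =
    Cond (Var 0)
      (Call UNIVERSE [Snd (Var 0),
        Call APPEND [Call OUTSIDE [Call COV [Fst (Var 0)], Var 1], Var 1]])
      (Var 1)"

definition MINIMUM_body :: expr where \<comment> \<open>arguments: m, n\<close>
  "MINIMUM_body =
    Cond (Var 0)
      (Cond (Var 1) (MkCell MkNull (Call MINIMUM [Snd (Var 0), Snd (Var 1)])) MkNull)
      MkNull"

definition BASE_body :: expr where \<comment> \<open>arguments: slots, n\<close>
  "BASE_body =
    Cond (Var 0)
      (MkCell (Call BASE [Snd (Var 0), Var 1])
        (Call BASE [Snd (Var 0), MkCell MkNull (Var 1)]))
      (Var 1)"

definition POINTMIN_body :: expr where \<comment> \<open>arguments: slots, table, table\<close>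
  "POINTMIN_body =
    Cond (Var 0)
      (MkCell (Call POINTMIN [Snd (Var 0), Fst (Var 1), Fst (Var 2)])
        (Call POINTMIN [Snd (Var 0), Snd (Var 1), Snd (Var 2)]))
      (Call MINIMUM [Var 1, Var 2])"

definition ADDSET_body :: expr where \<comment> \<open>arguments: slots, set, table, table\<close>
  "ADDSET_body =
    Cond (Var 0)
      (MkCell (Call ADDSET [Snd (Var 0), Var 1, Fst (Var 2), Fst (Var 3)])
        (Call ADDSET [Snd (Var 0), Var 1, Snd (Var 2),
          Cond (Call MEM [Fst (Var 0), Var 1]) (Fst (Var 3)) (Snd (Var 3))]))
      (Call MINIMUM [Var 2, MkCell MkNull (Var 3)])"

definition ADDSETS_body :: expr where \<comment> \<open>arguments: edges, slots, outer slots, table\<close>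
  "ADDSETS_body =
    Cond (Var 0)
      (Call ADDSETS [Snd (Var 0), Var 1, Var 2,
        Cond (Call SUBSET [Call COV [Fst (Var 0)], Var 1])
          (Cond (Call SUBSET [Call COV [Fst (Var 0)], Var 2])
            (Var 3)
            (Call ADDSET [Var 1, Call COV [Fst (Var 0)], Var 3, Var 3]))
          (Var 3)])
      (Var 3)"

definition JOIN_body :: expr where \<comment> \<open>arguments: slots, common slots, table, table of the common slots\<close>
  "JOIN_body =
    Cond (Var 0)
      (Cond (Call MEM [Fst (Var 0), Var 1])
        (MkCell (Call JOIN [Snd (Var 0), Var 1, Fst (Var 2), Fst (Var 3)])
          (Call POINTMIN [Snd (Var 0),
            Call JOIN [Snd (Var 0), Var 1, Snd (Var 2), Fst (Var 3)],
            Call JOIN [Snd (Var 0), Var 1, Fst (Var 2), Snd (Var 3)]]))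
        (MkCell (Call JOIN [Snd (Var 0), Var 1, Fst (Var 2), Var 3])
          (Call JOIN [Snd (Var 0), Var 1, Snd (Var 2), Var 3])))
      (Call APPEND [Var 2, Var 3])"

definition DOWN_body :: expr where \<comment> \<open>arguments: slots, table\<close>
  "DOWN_body =
    Cond (Var 0) (Call DOWN [Snd (Var 0), Snd (Var 1)]) (Var 1)"

definition PROC_body :: expr where \<comment> \<open>arguments: tree, edges, universe, outer slots, table\<close>
  "PROC_body =
    Call PROCNEW [Var 0, Var 1, Var 2, Var 3, Var 4,
      Call OUTSIDE [Call SLOTS [Var 2, Fst (Var 0)], Var 3]]"

definition PROCNEW_body :: expr where \<comment> \<open>arguments: tree, edges, universe, outer slots, table, new slots\<close>
  "PROCNEW_body =
    Cond (Var 5)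
      (Call JOIN [Var 3, Call SLOTS [Var 3, Fst (Var 0)], Var 4,
        Call DOWN [Var 5,
          Call FOLD [Snd (Var 0), Var 1, Var 2,
            Call APPEND [Var 5, Call SLOTS [Var 3, Fst (Var 0)]],
            Call ADDSETS [Var 1, Call APPEND [Var 5, Call SLOTS [Var 3, Fst (Var 0)]], Var 3,
              Call BASE [Call APPEND [Var 5, Call SLOTS [Var 3, Fst (Var 0)]], MkNull]]]]])
      (Call FOLD [Snd (Var 0), Var 1, Var 2, Var 3, Var 4])"

definition FOLD_body :: expr where \<comment> \<open>arguments: trees, edges, universe, outer slots, table\<close>
  "FOLD_body =
    Cond (Var 0)
      (Call FOLD [Snd (Var 0), Var 1, Var 2, Var 3,
        Call PROC [Fst (Var 0), Var 1, Var 2, Var 3, Var 4]])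
      (Var 4)"

definition INCR_body :: expr where \<comment> \<open>arguments: binary\<close>
  "INCR_body =
    Cond (Var 0)
      (Cond (Fst (Var 0)) (MkCell MkNull (Call INCR [Snd (Var 0)])) (MkCell MkTrue (Snd (Var 0))))
      (MkCell MkTrue MkNull)"

definition TOBIN_body :: expr where \<comment> \<open>arguments: unary\<close>
  "TOBIN_body =
    Cond (Var 0) (Call INCR [Call TOBIN [Snd (Var 0)]]) MkNull"

definition prog :: program where
  "prog = [MAIN_body, EQ_body, MEM_body, SUBSET_body, APPEND_body, OUTSIDE_body, SLOTS_body, PAIRS_body, COV_body, UNIVERSE_body, MINIMUM_body, BASE_body, POINTMIN_body, ADDSET_body, ADDSETS_body, JOIN_body, DOWN_body, PROC_body, PROCNEW_body, FOLD_body, INCR_body, TOBIN_body]"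

lemma prog_nth [simp]:
  "prog ! MAIN = MAIN_body" "MAIN < length prog"
  "prog ! EQ = EQ_body" "EQ < length prog"
  "prog ! MEM = MEM_body" "MEM < length prog"
  "prog ! SUBSET = SUBSET_body" "SUBSET < length prog"
  "prog ! APPEND = APPEND_body" "APPEND < length prog"
  "prog ! OUTSIDE = OUTSIDE_body" "OUTSIDE < length prog"
  "prog ! SLOTS = SLOTS_body" "SLOTS < length prog"
  "prog ! PAIRS = PAIRS_body" "PAIRS < length prog"
  "prog ! COV = COV_body" "COV < length prog"
  "prog ! UNIVERSE = UNIVERSE_body" "UNIVERSE < length prog"
  "prog ! MINIMUM = MINIMUM_body" "MINIMUM < length prog"
  "prog ! BASE = BASE_body" "BASE < length prog"
  "prog ! POINTMIN = POINTMIN_body" "POINTMIN < length prog"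
  "prog ! ADDSET = ADDSET_body" "ADDSET < length prog"
  "prog ! ADDSETS = ADDSETS_body" "ADDSETS < length prog"
  "prog ! JOIN = JOIN_body" "JOIN < length prog"
  "prog ! DOWN = DOWN_body" "DOWN < length prog"
  "prog ! PROC = PROC_body" "PROC < length prog"
  "prog ! PROCNEW = PROCNEW_body" "PROCNEW < length prog"
  "prog ! FOLD = FOLD_body" "FOLD < length prog"
  "prog ! INCR = INCR_body" "INCR < length prog"
  "prog ! TOBIN = TOBIN_body" "TOBIN < length prog"
  by (simp_all add: prog_def index_defs)

section \<open>A calculus of terminating runs with step bounds\<close>

section \<open>Weakest preconditions\<close>

text \<open>The existence of a derivation makes this total correctness; the postcondition also sees
  the step count.\<close>

definition wp :: "expr \<Rightarrow> val list \<Rightarrow> (val \<Rightarrow> nat \<Rightarrow> bool) \<Rightarrow> bool" where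
  "wp e env Q \<longleftrightarrow> (\<exists>v n. eval prog env e v n \<and> Q v n)"

definition wps :: "expr list \<Rightarrow> val list \<Rightarrow> (val list \<Rightarrow> nat \<Rightarrow> bool) \<Rightarrow> bool" where
  "wps es env Q \<longleftrightarrow> (\<exists>vs n. evals prog env es vs n \<and> Q vs n)"

text \<open>Kept folded, so that symbolic execution of a body stops at each call, where
  \<open>wp_callI\<close> inserts the specification of the callee.\<close>

definition wp_call :: "nat \<Rightarrow> val list \<Rightarrow> (val \<Rightarrow> nat \<Rightarrow> bool) \<Rightarrow> bool" where
  "wp_call f xs Q \<longleftrightarrow> f < length prog \<and> wp (prog ! f) xs Q"

definition runs :: "nat \<Rightarrow> val list \<Rightarrow> val \<Rightarrow> nat \<Rightarrow> bool" where
  "runs f xs v b \<longleftrightarrow> wp_call f xs (\<lambda>v' n. v' = v \<and> n \<le> b)"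

inductive_cases eval_elims:
  "eval P env (Var i) v n" "eval P env MkNull v n" "eval P env (MkCell a b) v n"
  "eval P env (Fst a) v n" "eval P env (Snd a) v n" "eval P env (Cond a b c) v n"
  "eval P env (Call f es) v n" "evals P env [] vs n" "evals P env (e # es) vs n"

lemma wp_simps [simp]:
  "wp (Var i) env Q \<longleftrightarrow> i < length env \<and> Q (env ! i) 1"
  "wp MkNull env Q \<longleftrightarrow> Q Null 1"
  "wp (MkCell a b) env Q \<longleftrightarrow> wp a env (\<lambda>x m. wp b env (\<lambda>y n. Q (Cell x y) (m + n + 1)))"
  "wp (Fst a) env Q \<longleftrightarrow> wp a env (\<lambda>x m. Q (val_fst x) (m + 1))"
  "wp (Snd a) env Q \<longleftrightarrow> wp a env (\<lambda>x m. Q (val_snd x) (m + 1))"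
  unfolding wp_def by (fastforce elim!: eval_elims intro: eval_evals.intros)+

lemma wp_Cond [simp]:
  "wp (Cond a b c) env Q \<longleftrightarrow>
     wp a env (\<lambda>x m. if x = Null then wp c env (\<lambda>y n. Q y (m + n + 1))
       else wp b env (\<lambda>y n. Q y (m + n + 1)))" (is "?l \<longleftrightarrow> ?r")
proof
  show "?l \<Longrightarrow> ?r"
    unfolding wp_def by (auto elim!: eval_elims)
  show "?r \<Longrightarrow> ?l"
    unfolding wp_def by (auto split: if_splits intro: eval_evals.intros)
      (metis Cond_true Cond_false Suc_eq_plus1)+
qed

lemma wp_Call [simp]:
  "wp (Call f es) env Q \<longleftrightarrow> wps es env (\<lambda>xs m. wp_call f xs (\<lambda>y n. Q y (m + n + 1)))"
  unfolding wp_def wps_def wp_call_def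
  by (auto elim!: eval_elims) (metis Call Suc_eq_plus1)+

lemma wps_simps [simp]:
  "wps [] env Q \<longleftrightarrow> Q [] 0"
  "wps (e # es) env Q \<longleftrightarrow> wp e env (\<lambda>x m. wps es env (\<lambda>xs n. Q (x # xs) (m + n)))"
  unfolding wps_def wp_def
  by (auto elim!: eval_elims intro: eval_evals.intros)

lemma wp_callI:
  "runs f xs v b \<Longrightarrow> ys = xs \<Longrightarrow> (\<And>n. n \<le> b \<Longrightarrow> Q v n) \<Longrightarrow> wp_call f ys Q"
  unfolding runs_def wp_call_def wp_def by blast

lemma runsI: "f < length prog \<Longrightarrow> wp (prog ! f) xs (\<lambda>v' n. v' = v \<and> n \<le> b) \<Longrightarrow> runs f xs v b"
  unfolding runs_def wp_call_def by blast

lemma runs_mono: "runs f xs v b \<Longrightarrow> b \<le> c \<Longrightarrow> runs f xs v c"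
  by (auto simp: runs_def wp_call_def wp_def)

lemma enc_list_simps [simp]:
  "enc_list [] = Null"
  "enc_list (x # xs) = Cell x (enc_list xs)"
  by (simp_all add: enc_list_def)

definition bval :: "bool \<Rightarrow> val" where
  "bval b = (if b then Cell Null Null else Null)"

lemma bval_eq_Null [simp]: "bval b = Null \<longleftrightarrow> \<not> b"
  by (simp add: bval_def)

section \<open>Generic list functions, binary and unary numbers\<close>

section \<open>Lists and numbers\<close>

text \<open>Both arguments are descended in parallel, so the size of the first one alone bounds the
  time.\<close>

lemma runs_EQ: "runs EQ [x, y] (bval (x = y)) (30 * val_size x)"
proof (induction x arbitrary: y)
  case Null
  show ?case
    by (rule runsI) (auto simp: EQ_body_def bval_def)
next
  case (Cell a b)
  show ?case
  proof (cases y)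
    case Null
    then show ?thesis
      by (intro runsI) (auto simp: EQ_body_def bval_def)
  next
    case y: (Cell c d)
    show ?thesis
      unfolding y
      apply (rule runsI)
       apply (simp_all add: EQ_body_def)
      apply (rule wp_callI[OF Cell.IH(1) refl])
      apply (cases "a = c")
       apply simp
       apply (rule wp_callI[OF Cell.IH(2) refl])
       apply (auto simp: bval_def)
      done
  qed
qed

definition mem_cost :: "nat \<Rightarrow> nat \<Rightarrow> nat" where
  "mem_cost s l = (30 * s + 20) * (l + 1)"

lemma runs_MEM:
  assumes "val_size x \<le> s"
  shows "runs MEM [x, enc_list ys] (bval (x \<in> set ys)) (mem_cost s (length ys))"
proof (induction ys)
  case Nil
  show ?case
    by (rule runsI) (auto simp: MEM_body_def bval_def mem_cost_def)
next
  case (Cons y ys)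
  show ?case
    apply (rule runsI)
     apply (simp_all add: MEM_body_def)
    apply (rule wp_callI[OF runs_EQ refl])
    apply (cases "x = y")
    using assms apply (simp add: bval_def mem_cost_def)
    apply simp
    apply (rule wp_callI[OF Cons refl])
    using assms apply (simp add: bval_def mem_cost_def)
    done
qed

lemma runs_SUBSET:
  assumes "\<forall>x\<in>set xs. val_size x \<le> s"
  shows "runs SUBSET [enc_list xs, enc_list ys] (bval (set xs \<subseteq> set ys))
    ((mem_cost s (length ys) + 20) * (length xs + 1))"
  using assms
proof (induction xs)
  case Nil
  show ?case
    by (rule runsI) (auto simp: SUBSET_body_def bval_def)
next
  case (Cons x xs)
  from Cons.prems have IH: "runs SUBSET [enc_list xs, enc_list ys] (bval (set xs \<subseteq> set ys))
    ((mem_cost s (length ys) + 20) * (length xs + 1))"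
    and x: "val_size x \<le> s" using Cons.IH by auto
  show ?case
    apply (rule runsI)
     apply (simp_all add: SUBSET_body_def)
    apply (rule wp_callI[OF runs_MEM[OF x] refl])
    apply (cases "x \<in> set ys")
     apply simp
     apply (rule wp_callI[OF IH refl])
    by (auto simp: bval_def algebra_simps)
qed

lemma runs_APPEND: "runs APPEND [enc_list xs, enc_list ys] (enc_list (xs @ ys)) (20 * (length xs + 1))"
proof (induction xs)
  case Nil
  show ?case
    by (rule runsI) (auto simp: APPEND_body_def)
next
  case (Cons x xs)
  show ?case
    apply (rule runsI)
     apply (simp_all add: APPEND_body_def)
    apply (rule wp_callI[OF Cons refl])
    apply simp
    done
qed

lemma runs_OUTSIDE:
  assumes "\<forall>x\<in>set xs. val_size x \<le> s"
  shows "runs OUTSIDE [enc_list xs, enc_list ys] (enc_list (filter (\<lambda>x. x \<notin> set ys) xs))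
    ((mem_cost s (length ys) + 30) * (length xs + 1))"
  using assms
proof (induction xs)
  case Nil
  show ?case
    by (rule runsI) (auto simp: OUTSIDE_body_def)
next
  case (Cons x xs)
  from Cons.prems have x: "val_size x \<le> s" by simp
  from Cons have IH: "runs OUTSIDE [enc_list xs, enc_list ys] (enc_list (filter (\<lambda>x. x \<notin> set ys) xs))
    ((mem_cost s (length ys) + 30) * (length xs + 1))" by simp
  show ?case
  proof (cases "x \<in> set ys")
    case True
    then show ?thesis
      apply (intro runsI)
       apply (simp_all add: OUTSIDE_body_def)
      apply (rule wp_callI[OF runs_MEM[OF x] refl])
      apply simp
      apply (rule wp_callI[OF IH refl])
      apply (simp add: algebra_simps)
      done
  next
    case False
    then show ?thesis
      apply (intro runsI)
       apply (simp_all add: OUTSIDE_body_def)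
      apply (rule wp_callI[OF runs_MEM[OF x] refl])
      apply simp
      apply (rule wp_callI[OF IH refl])
      apply (simp add: algebra_simps)
      done
  qed
qed

text \<open>Vertices and times are compared through their codes; this is sound because parity and
  half determine a number.\<close>

lemma enc_nat_inject [simp]: "enc_nat m = enc_nat n \<longleftrightarrow> m = n"
proof (induction m arbitrary: n rule: less_induct)
  case (less m)
  show ?case
  proof
    assume eq: "enc_nat m = enc_nat n"
    show "m = n"
    proof (cases "m = 0 \<or> n = 0")
      case True
      with eq show ?thesis
        by (subst (asm) (1 2) enc_nat.simps) (auto split: if_splits)
    next
      case False
      with eq have "even m = even n" "enc_nat (m div 2) = enc_nat (n div 2)"
        by (subst (asm) (1 2) enc_nat.simps; auto split: if_splits)+
      with less.IH[of "m div 2" "n div 2"] False have "m mod 2 = n mod 2" "m div 2 = n div 2"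
        by (auto simp: even_iff_mod_2_eq_zero)
      then show ?thesis
        by (metis div_mult_mod_eq)
    qed
  qed simp
qed

text \<open>A bound linear in the value rather than in its length suffices: only the final optimum,
  a polynomially bounded number, is converted.\<close>

lemma runs_INCR: "runs INCR [enc_nat n] (enc_nat (Suc n)) (30 * (n + 1))"
proof (induction n rule: less_induct)
  case (less n)
  show ?case
  proof (cases "odd n")
    case False
    then have 1: "enc_nat (Suc n) = Cell (Cell Null Null) (enc_nat (n div 2))"
      by (subst enc_nat.simps) simp
    have 2: "enc_nat n = (if n = 0 then Null else Cell Null (enc_nat (n div 2)))"
      using False by (subst enc_nat.simps) simp
    show ?thesis
      unfolding 1 2 by (rule runsI) (auto simp: INCR_body_def enc_nat.simps[of 0])
  next
    case True
    then have "n \<noteq> 0" by (rule contrapos_pn) simp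
    then have n: "n div 2 < n" "n \<noteq> 0" by auto
    have 1: "enc_nat (Suc n) = Cell Null (enc_nat (Suc (n div 2)))"
      using True by (subst enc_nat.simps) simp
    have 2: "enc_nat n = Cell (Cell Null Null) (enc_nat (n div 2))"
      using True n by (subst enc_nat.simps) simp
    show ?thesis
      unfolding 1 2
      apply (rule runsI)
       apply (simp_all add: INCR_body_def)
      apply (rule wp_callI[OF less[OF n(1)] refl])
      using n by simp
  qed
qed

definition un :: "nat \<Rightarrow> val" where
  "un n = enc_list (replicate n Null)"

lemma un_simps [simp]: "un 0 = Null" "un (Suc n) = Cell Null (un n)"
  by (simp_all add: un_def)

lemma runs_TOBIN: "runs TOBIN [un n] (enc_nat n) (50 * (n + 1) * (n + 1))"
proof (induction n)
  case 0
  show ?case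
    by (rule runsI) (auto simp: TOBIN_body_def enc_nat.simps[of 0])
next
  case (Suc n)
  show ?case
    apply (rule runsI)
     apply (simp_all add: TOBIN_body_def)
    apply (rule wp_callI[OF Suc refl])
    apply simp
    apply (rule wp_callI[OF runs_INCR refl])
    apply (simp add: algebra_simps)
    done
qed

lemma runs_APPEND_un: "runs APPEND [un m, un n] (un (m + n)) (20 * (m + 1))"
  using runs_APPEND[of "replicate m Null" "replicate n Null"] by (simp add: un_def replicate_add)

lemma runs_MINIMUM: "runs MINIMUM [un m, un n] (un (min m n)) (20 * (m + 1))"
proof (induction m arbitrary: n)
  case 0
  show ?case
    by (rule runsI) (auto simp: MINIMUM_body_def)
next
  case (Suc m)
  show ?case
  proof (cases n)
    case 0
    show ?thesis unfolding 0
      by (rule runsI) (auto simp: MINIMUM_body_def)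
  next
    case n: (Suc n')
    show ?thesis unfolding n
      apply (rule runsI)
       apply (simp_all add: MINIMUM_body_def)
      apply (rule wp_callI[OF Suc refl])
      apply simp
      done
  qed
qed

section \<open>Slots and the sets of slots that edges cover\<close>

section \<open>Slots and edges\<close>

type_synonym slot = "nat \<times> nat"
type_synonym edge = "nat \<times> nat \<times> nat list"

definition enc_slot :: "slot \<Rightarrow> val" where
  "enc_slot s = Cell (enc_nat (fst s)) (enc_nat (snd s))"

definition enc_slots :: "slot list \<Rightarrow> val" where
  "enc_slots L = enc_list (map enc_slot L)"

definition enc_edge :: "edge \<Rightarrow> val" where
  "enc_edge e = Cell (enc_nat (fst e)) (Cell (enc_nat (fst (snd e))) (enc_list (map enc_nat (snd (snd e)))))"

lemma enc_slots_simps [simp]: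
  "enc_slots [] = Null" "enc_slots (s # L) = Cell (enc_slot s) (enc_slots L)"
  by (simp_all add: enc_slots_def)

lemma enc_slot_inject [simp]: "enc_slot s = enc_slot t \<longleftrightarrow> s = t"
  by (simp add: enc_slot_def prod_eq_iff)

lemma enc_slot_in_image [simp]: "enc_slot s \<in> enc_slot ` A \<longleftrightarrow> s \<in> A"
  by (auto simp: image_iff)

lemma runs_MEM_slots:
  assumes "val_size (enc_slot x) \<le> s"
  shows "runs MEM [enc_slot x, enc_slots L] (bval (x \<in> set L)) (mem_cost s (length L))"
  using runs_MEM[OF assms, of "map enc_slot L"] by (simp add: enc_slots_def)

lemma runs_SUBSET_slots:
  assumes "\<forall>x\<in>set K. val_size (enc_slot x) \<le> s"
  shows "runs SUBSET [enc_slots K, enc_slots L] (bval (set K \<subseteq> set L))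
    ((mem_cost s (length L) + 20) * (length K + 1))"
proof -
  have "enc_slot ` set K \<subseteq> enc_slot ` set L \<longleftrightarrow> set K \<subseteq> set L"
    by (rule inj_image_subset_iff) (simp add: inj_def)
  with runs_SUBSET[of "map enc_slot K" s "map enc_slot L"] assms show ?thesis
    by (simp add: enc_slots_def)
qed

lemma runs_OUTSIDE_slots:
  assumes "\<forall>x\<in>set K. val_size (enc_slot x) \<le> s"
  shows "runs OUTSIDE [enc_slots K, enc_slots L] (enc_slots (filter (\<lambda>x. x \<notin> set L) K))
    ((mem_cost s (length L) + 30) * (length K + 1))"
  using runs_OUTSIDE[of "map enc_slot K" s "map enc_slot L"] assms
  by (simp add: enc_slots_def filter_map o_def)

lemma runs_APPEND_slots:
  "runs APPEND [enc_slots K, enc_slots L] (enc_slots (K @ L)) (20 * (length K + 1))"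
  using runs_APPEND[of "map enc_slot K" "map enc_slot L"] by (simp add: enc_slots_def)

text \<open>A filter keeps the order of \<open>L\<close>, which aligns a table over the shared slots
  with the table over \<open>L\<close>.\<close>

definition slots_in :: "nat set \<Rightarrow> slot list \<Rightarrow> slot list" where
  "slots_in X L = filter (\<lambda>s. fst s \<in> X) L"

lemma runs_SLOTS:
  assumes "\<forall>x\<in>set L. val_size (enc_slot x) \<le> s"
  shows "runs SLOTS [enc_slots L, enc_list (map enc_nat b)] (enc_slots (slots_in (set b) L))
    ((mem_cost s (length b) + 30) * (length L + 1))"
  using assms
proof (induction L)
  case Nil
  show ?case
    by (rule runsI) (auto simp: SLOTS_body_def slots_in_def)
next
  case (Cons x L)
  from Cons.prems have x: "val_size (enc_nat (fst x)) \<le> s" by (simp add: enc_slot_def)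
  have MEM: "runs MEM [enc_nat (fst x), enc_list (map enc_nat b)] (bval (fst x \<in> set b))
      (mem_cost s (length b))"
    using runs_MEM[OF x, of "map enc_nat b"] by (simp add: image_iff)
  have 1: "val_fst (enc_slot x) = enc_nat (fst x)" by (simp add: enc_slot_def)
  from Cons have IH: "runs SLOTS [enc_slots L, enc_list (map enc_nat b)] (enc_slots (slots_in (set b) L))
    ((mem_cost s (length b) + 30) * (length L + 1))" by simp
  show ?case
  proof (cases "fst x \<in> set b")
    case True
    then show ?thesis
      apply (intro runsI)
       apply (simp_all add: SLOTS_body_def 1)
      apply (rule wp_callI[OF MEM refl])
      apply simp
      apply (rule wp_callI[OF IH refl])
      apply (simp add: algebra_simps slots_in_def)
      done
  next
    case False
    then show ?thesis
      apply (intro runsI)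
       apply (simp_all add: SLOTS_body_def 1)
      apply (rule wp_callI[OF MEM refl])
      apply simp
      apply (rule wp_callI[OF IH refl])
      apply (simp add: algebra_simps slots_in_def)
      done
  qed
qed

lemma runs_PAIRS:
  "runs PAIRS [enc_nat u, enc_list (map enc_nat ls)] (enc_slots (map (Pair u) ls)) (20 * (length ls + 1))"
proof (induction ls)
  case Nil
  show ?case
    by (rule runsI) (auto simp: PAIRS_body_def)
next
  case (Cons l ls)
  show ?case
    apply (rule runsI)
     apply (simp_all add: PAIRS_body_def)
    apply (rule wp_callI[OF Cons refl])
    apply (simp add: enc_slot_def)
    done
qed

fun cov :: "edge \<Rightarrow> slot list" where
  "cov (u, v, ls) = map (Pair u) ls @ map (Pair v) ls"

lemma runs_COV: "runs COV [enc_edge e] (enc_slots (cov e)) (100 * (length (cov e) + 1))"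
proof -
  obtain u v ls where e: "e = (u, v, ls)" by (cases e)
  show ?thesis
    unfolding e
    apply (rule runsI)
     apply (simp_all add: COV_body_def enc_edge_def)
    apply (rule wp_callI[OF runs_PAIRS refl])
    apply (rule wp_callI[OF runs_PAIRS refl])
    apply (rule wp_callI[OF runs_APPEND_slots refl])
    apply simp
    done
qed

primrec universe :: "edge list \<Rightarrow> slot list \<Rightarrow> slot list" where
  "universe [] L = L"
| "universe (e # es) L = universe es (filter (\<lambda>s. s \<notin> set L) (cov e) @ L)"

text \<open>The accumulator only grows, so a bound on the final list bounds every intermediate
  one.\<close>

lemma length_universe_ge: "length L \<le> length (universe es L)"
proof (induction es arbitrary: L)
  case (Cons e es)
  have "length L \<le> length (filter (\<lambda>s. s \<notin> set L) (cov e) @ L)" by simp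
  also note Cons
  finally show ?case by simp
qed simp

lemma mem_cost_mono: "a \<le> c \<Longrightarrow> b \<le> d \<Longrightarrow> mem_cost a b \<le> mem_cost c d"
  unfolding mem_cost_def by (intro mult_le_mono) auto

lemma runs_UNIVERSE:
  assumes "length (universe es L) \<le> k"
    and "\<forall>e\<in>set es. length (cov e) \<le> k \<and> (\<forall>x\<in>set (cov e). val_size (enc_slot x) \<le> k)"
  shows "runs UNIVERSE [enc_list (map enc_edge es), enc_slots L] (enc_slots (universe es L))
    ((mem_cost k k + 200) * (k + 1) * (length es + 1))"
  using assms
proof (induction es arbitrary: L)
  case Nil
  show ?case
    by (rule runsI) (auto simp: UNIVERSE_body_def)
next
  case (Cons e es)
  let ?L = "filter (\<lambda>s. s \<notin> set L) (cov e) @ L"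
  have L: "length L \<le> k" using Cons.prems length_universe_ge[of L "e # es"] by simp
  have e: "length (cov e) \<le> k" "\<forall>x\<in>set (cov e). val_size (enc_slot x) \<le> k"
    using Cons.prems by auto
  have IH: "runs UNIVERSE [enc_list (map enc_edge es), enc_slots ?L] (enc_slots (universe es ?L))
    ((mem_cost k k + 200) * (k + 1) * (length es + 1))"
    using Cons by simp
  have f: "length (filter (\<lambda>s. s \<notin> set L) (cov e)) \<le> k"
    using e le_trans length_filter_le by blast
  have m: "(mem_cost k (length L) + 30) * (length (cov e) + 1) \<le> (mem_cost k k + 30) * (k + 1)"
    using L e by (intro mult_le_mono add_le_mono mem_cost_mono) auto
  show ?case
    apply (rule runsI)
     apply (simp_all add: UNIVERSE_body_def)
    apply (rule wp_callI[OF runs_COV refl])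
    apply (rule wp_callI[OF runs_OUTSIDE_slots[OF e(2)] refl])
    apply (rule wp_callI[OF runs_APPEND_slots refl])
    apply (rule wp_callI[OF IH refl])
    using m f e(1) apply (simp add: algebra_simps)
    done
qed

section \<open>Functions on the subsets of a list, stored as trees, and the operations on
  them\<close>

section \<open>Tables\<close>

text \<open>A decision tree on membership in the demand. The function is partially evaluated on the
  way down, so each subtree is again a table.\<close>

primrec table :: "'s list \<Rightarrow> ('s set \<Rightarrow> nat) \<Rightarrow> val" where
  "table [] f = un (f {})"
| "table (x # L) f = Cell (table L f) (table L (\<lambda>D. f (insert x D)))"

text \<open>Admits rewriting by facts that need a finite demand, or one without the head of the
  list.\<close>

lemma table_cong: "(\<And>D. D \<subseteq> set L \<Longrightarrow> f D = g D) \<Longrightarrow> table L f = table L g"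
proof (induction L arbitrary: f g)
  case (Cons x L)
  have "f D = g D" "f (insert x D) = g (insert x D)" if "D \<subseteq> set L" for D
    using Cons.prems[of D] Cons.prems[of "insert x D"] that by auto
  then have "table L f = table L g" "table L (\<lambda>D. f (insert x D)) = table L (\<lambda>D. g (insert x D))"
    by (intro Cons.IH; blast)+
  then show ?case by simp
qed simp

text \<open>The number of nodes of a full binary tree of height \<open>n\<close>, hence of calls
  made by an operation that recurses into both halves of a table.\<close>

primrec tree_count :: "nat \<Rightarrow> nat" where
  "tree_count 0 = 1"
| "tree_count (Suc n) = 2 * tree_count n + 1"

lemma tree_count_le: "tree_count n \<le> 2 * 2 ^ n"
proof -
  have "tree_count n + 1 = 2 * 2 ^ n" by (induction n) auto
  then show ?thesis by simp
qed

text \<open>The table before any edge is used: each demanded slot pays its penalty. The accumulator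
  \<open>k\<close> carries the penalties of slots already passed.\<close>

lemma runs_BASE:
  "distinct L \<Longrightarrow>
    runs BASE [enc_slots L, un k] (table L (\<lambda>D. k + card D)) (20 * tree_count (length L))"
proof (induction L arbitrary: k)
  case Nil
  show ?case
    by (rule runsI) (auto simp: BASE_body_def)
next
  case (Cons x L)
  then have IH: "runs BASE [enc_slots L, un k] (table L (\<lambda>D. k + card D)) (20 * tree_count (length L))" for k
    by simp
  have 1: "table L (\<lambda>D. Suc k + card D) = table L (\<lambda>D. k + card (insert x D))"
  proof (rule table_cong)
    fix D assume "D \<subseteq> set L"
    then show "Suc k + card D = k + card (insert x D)"
      using Cons.prems by (subst card_insert_disjoint) (auto dest: finite_subset)
  qed
  show ?case
    apply (rule runsI)
     apply (simp_all add: BASE_body_def)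
    apply (rule wp_callI[OF IH refl])
    apply (rule wp_callI[OF IH[of "Suc k"]])
     apply simp
    apply (simp add: 1[simplified])
    done
qed

lemma runs_POINTMIN:
  "(\<And>D. D \<subseteq> set L \<Longrightarrow> f D \<le> M) \<Longrightarrow>
    runs POINTMIN [enc_slots L, table L f, table L g] (table L (\<lambda>D. min (f D) (g D)))
      ((20 * M + 60) * tree_count (length L))"
proof (induction L arbitrary: f g)
  case Nil
  show ?case
    apply (rule runsI)
     apply (simp_all add: POINTMIN_body_def)
    apply (rule wp_callI[OF runs_MINIMUM refl])
    using Nil by simp
next
  case (Cons x L)
  have 1: "D \<subseteq> set L \<Longrightarrow> f D \<le> M" for D
    using Cons.prems[of D] by auto
  have 2: "D \<subseteq> set L \<Longrightarrow> f (insert x D) \<le> M" for D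
    using Cons.prems[of "insert x D"] by auto
  show ?case
    apply (rule runsI)
     apply (simp_all add: POINTMIN_body_def)
    apply (rule wp_callI[OF Cons.IH refl], erule 1)
    apply (rule wp_callI[OF Cons.IH refl], erule 2)
    apply (simp add: algebra_simps)
    done
qed

text \<open>Both tables start out equal: \<open>f\<close> stands for leaving the edge out and
  \<open>g\<close> for taking it. They are generalised because, at a demanded slot covered by the
  edge, \<open>f\<close> goes right while \<open>g\<close> goes left.\<close>

lemma runs_ADDSET:
  assumes "distinct L" "\<And>D. D \<subseteq> set L \<Longrightarrow> f D \<le> M" "\<forall>x\<in>set L. val_size (enc_slot x) \<le> s"
  shows "runs ADDSET [enc_slots L, enc_slots C, table L f, table L g]
    (table L (\<lambda>D. min (f D) (Suc (g (D - set C)))))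
    ((mem_cost s (length C) + 20 * M + 100) * tree_count (length L))"
  using assms
proof (induction L arbitrary: f g)
  case Nil
  show ?case
    apply (rule runsI)
     apply (simp_all add: ADDSET_body_def)
    apply (rule wp_callI[OF runs_MINIMUM[of _ "Suc (g {})"]])
     apply simp
    using Nil by simp
next
  case (Cons x L)
  have x: "val_size (enc_slot x) \<le> s" using Cons.prems by simp
  have IH: "runs ADDSET [enc_slots L, enc_slots C, table L f', table L g']
    (table L (\<lambda>D. min (f' D) (Suc (g' (D - set C)))))
    ((mem_cost s (length C) + 20 * M + 100) * tree_count (length L))"
    if "\<And>D. D \<subseteq> set L \<Longrightarrow> f' D \<le> M" for f' g'
    using Cons that by simp
  have 1: "D \<subseteq> set L \<Longrightarrow> f D \<le> M" for D
    using Cons.prems(2)[of D] by auto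
  have 2: "D \<subseteq> set L \<Longrightarrow> f (insert x D) \<le> M" for D
    using Cons.prems(2)[of "insert x D"] by auto
  let ?g = "if x \<in> set C then g else (\<lambda>D. g (insert x D))"
  show ?case
    apply (rule runsI)
     apply (simp_all add: ADDSET_body_def)
    apply (rule wp_callI[OF IH refl], erule 1)
    apply (rule wp_callI[OF runs_MEM_slots[OF x] refl])
    apply simp
    apply (intro conjI impI)
     apply (rule wp_callI[OF IH[OF 2, of "\<lambda>D. D" ?g]])
       apply simp
      apply (simp)
     apply (simp add: insert_Diff_if algebra_simps)
     apply (rule wp_callI[OF IH[OF 2, of "\<lambda>D. D" ?g]])
       apply simp
      apply (simp)
     apply (simp add: insert_Diff_if algebra_simps)
    done
qed

text \<open>The slots in \<open>K\<close> are about to be left behind and must all be demanded; as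
  they head the list, this only follows right branches.\<close>

lemma runs_DOWN:
  "runs DOWN [enc_slots K, table (K @ L) f] (table L (\<lambda>D. f (set K \<union> D))) (20 * (length K + 1))"
proof (induction K arbitrary: f)
  case Nil
  show ?case
    by (rule runsI) (auto simp: DOWN_body_def)
next
  case (Cons x K)
  show ?case
    apply (rule runsI)
     apply (simp_all add: DOWN_body_def)
    apply (rule wp_callI[OF Cons refl])
    apply simp
    done
qed

text \<open>A min-plus subset convolution restricted to splits whose second part lies in
  \<open>A\<close>; \<open>B\<close> is the part of the demand handed to \<open>g\<close>.\<close>

definition join :: "'s set \<Rightarrow> ('s set \<Rightarrow> nat) \<Rightarrow> ('s set \<Rightarrow> nat) \<Rightarrow> 's set \<Rightarrow> nat" where
  "join A f g D = Min ((\<lambda>B. f (D - B) + g B) ` Pow (D \<inter> A))"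

lemma join_le: "finite D \<Longrightarrow> join A f g D \<le> f D + g {}"
  unfolding join_def by (rule Min_le) (auto intro!: image_eqI[of _ _ "{}"])

lemma join_empty [simp]: "join A f g {} = f {} + g {}"
  by (simp add: join_def)

lemma join_insert_notin:
  assumes "x \<notin> A"
  shows "join A f g (insert x D) = join A (\<lambda>D. f (insert x D)) g D"
proof -
  have "insert x D - B = insert x (D - B)" if "B \<subseteq> D \<inter> A" for B
    using that assms by auto
  then show ?thesis
    using assms unfolding join_def by (auto intro!: arg_cong[of _ _ Min] image_cong)
qed

text \<open>Either \<open>x\<close> stays with \<open>f\<close> or it belongs to \<open>B\<close>.
  Together with an undemanded \<open>x\<close>, this makes three recursive calls for a common
  slot.\<close>

lemma join_insert_in:
  assumes "x \<in> A" "x \<notin> D" "finite D"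
  shows "join A f g (insert x D) =
    min (join A (\<lambda>D. f (insert x D)) g D) (join A f (\<lambda>D. g (insert x D)) D)"
proof -
  let ?h = "\<lambda>B. f (insert x D - B) + g B"
  have 1: "insert x D \<inter> A = insert x (D \<inter> A)" using assms by auto
  have 2: "?h ` Pow (D \<inter> A) = (\<lambda>B. f (insert x (D - B)) + g B) ` Pow (D \<inter> A)"
    using assms by (intro image_cong) (auto simp: insert_Diff_if)
  have 3: "?h ` insert x ` Pow (D \<inter> A) = (\<lambda>B. f (D - B) + g (insert x B)) ` Pow (D \<inter> A)"
    unfolding image_image using assms by (intro image_cong) auto
  have "join A f g (insert x D) = Min (?h ` Pow (D \<inter> A) \<union> ?h ` insert x ` Pow (D \<inter> A))"
    unfolding join_def 1 Pow_insert image_Un ..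
  also have "\<dots> = min (Min (?h ` Pow (D \<inter> A))) (Min (?h ` insert x ` Pow (D \<inter> A)))"
    using assms by (intro Min_Un) auto
  finally show ?thesis
    unfolding 2 3 join_def .
qed

text \<open>One level of a recursion with growth factor \<open>k\<close>: raising \<open>l\<close>
  by one leaves \<open>k * (c * x)\<close> to pay for the work outside the recursive calls.\<close>

lemma cost_split: "c * (l + 1 + 1) * (k * x) = k * (c * (l + 1) * x) + k * (c * x)"
  for c l k x :: nat
  by (simp add: algebra_simps)

text \<open>A slot outside \<open>A\<close> causes two recursive calls, a slot in \<open>A\<close>
  three and a pass of \<open>POINTMIN\<close>. Allowing a factor 4 for the latter makes slots of
  \<open>A\<close> count twice in the exponent.\<close>

lemma runs_JOIN:
  assumes "distinct L" "\<forall>x\<in>set L. val_size (enc_slot x) \<le> s"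
    and "\<And>D. D \<subseteq> set L \<Longrightarrow> f D \<le> M" "g {} \<le> M" "\<And>D. D \<subseteq> set L \<Longrightarrow> g D \<le> M"
  shows "runs JOIN [enc_slots L, enc_slots A, table L f, table (filter (\<lambda>x. x \<in> set A) L) g]
    (table L (join (set A) f g))
    ((mem_cost s (length A) + 40 * M + 200) * (length L + 1) *
      2 ^ (length L + length (filter (\<lambda>x. x \<in> set A) L)))"
  using assms
proof (induction L arbitrary: f g)
  case Nil
  show ?case
    apply (rule runsI)
     apply (simp_all add: JOIN_body_def)
    apply (rule wp_callI[OF runs_APPEND_un refl])
    using Nil by simp
next
  case (Cons x L)
  have x: "val_size (enc_slot x) \<le> s" using Cons.prems by simp
  let ?c = "mem_cost s (length A) + 40 * M + 200"
  let ?F = "filter (\<lambda>x. x \<in> set A) L"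
  define X :: nat where "X = 2 ^ (length L + length ?F)"
  have X: "2 ^ length L \<le> X" unfolding X_def by (rule power_increasing) auto
  have X1: "1 \<le> X" unfolding X_def by simp
  define b where "b = ?c * (length L + 1) * X"
  have IH: "runs JOIN [enc_slots L, enc_slots A, table L f', table ?F g'] (table L (join (set A) f' g')) b"
    if "\<And>D. D \<subseteq> set L \<Longrightarrow> f' D \<le> M" "\<And>D. D \<subseteq> set L \<Longrightarrow> g' D \<le> M" for f' g'
    unfolding b_def X_def using that Cons.prems(1,2) by (intro Cons.IH) auto
  have f: "f D \<le> M" "f (insert x D) \<le> M" "g D \<le> M" "g (insert x D) \<le> M" if "D \<subseteq> set L" for D
    using Cons.prems(3,5)[of D] Cons.prems(3,5)[of "insert x D"] that by auto
  show ?case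
  proof (cases "x \<in> set A")
    case False
    have t: "table L (\<lambda>D. join (set A) f g (insert x D)) = table L (join (set A) (\<lambda>D. f (insert x D)) g)"
      using False by (simp add: join_insert_notin)
    have e: "(2::nat) ^ (length (x # L) + length (filter (\<lambda>x. x \<in> set A) (x # L))) = 2 * X"
      using False by (simp add: X_def)
    define r where "r = ?c * (length (x # L) + 1) * (2 * X)"
    have c: "2 * b + mem_cost s (length A) + 200 \<le> r"
    proof -
      define Y where "Y = ?c * X"
      have "?c \<le> Y" using X1 unfolding Y_def by simp
      moreover have "r = 2 * b + 2 * Y"
        by (simp only: r_def b_def Y_def length_Cons Suc_eq_plus1) (rule cost_split)
      ultimately show ?thesis by linarith
    qed
    show ?thesis
      unfolding e r_def[symmetric]
      using False
      apply (intro runsI)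
       apply (simp_all only: prog_nth JOIN_body_def)
      apply (simp add: t)
      apply (rule wp_callI[OF runs_MEM_slots[OF x] refl])
      apply simp
      apply (rule wp_callI[OF IH refl], erule f, erule f)
      apply (rule wp_callI[OF IH refl], erule f, erule f)
      using c apply simp
      done
  next
    case True
    have t: "table L (\<lambda>D. join (set A) f g (insert x D)) =
       table L (\<lambda>D. min (join (set A) (\<lambda>D. f (insert x D)) g D) (join (set A) f (\<lambda>D. g (insert x D)) D))"
    proof (rule table_cong)
      fix D assume "D \<subseteq> set L"
      then show "join (set A) f g (insert x D) =
         min (join (set A) (\<lambda>D. f (insert x D)) g D) (join (set A) f (\<lambda>D. g (insert x D)) D)"
        using True Cons.prems(1) by (intro join_insert_in) (auto dest: finite_subset)
    qed
    have e: "(2::nat) ^ (length (x # L) + length (filter (\<lambda>x. x \<in> set A) (x # L))) = 4 * X"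
      using True by (simp add: X_def)
    define r where "r = ?c * (length (x # L) + 1) * (4 * X)"
    \<comment> \<open>A value of a join is at most a sum of two table values, hence
      \<open>2 * M\<close>.\<close>
    define p where "p = (20 * (2 * M) + 60) * tree_count (length L)"
    have c: "3 * b + mem_cost s (length A) + 200 + p \<le> r"
    proof -
      define Y where "Y = ?c * X"
      have "?c \<le> Y" using X1 unfolding Y_def by simp
      moreover have "p \<le> 2 * Y"
      proof -
        have "p \<le> ?c * (2 * X)"
          using tree_count_le[of "length L"] X unfolding p_def by (intro mult_le_mono) auto
        then show ?thesis by (simp only: Y_def mult.left_commute)
      qed
      moreover have "r = 4 * b + 4 * Y"
        by (simp only: r_def b_def Y_def length_Cons Suc_eq_plus1) (rule cost_split)
      ultimately show ?thesis by linarith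
    qed
    have P: "runs POINTMIN [enc_slots L, table L (join (set A) (\<lambda>D. f (insert x D)) g),
        table L (join (set A) f (\<lambda>D. g (insert x D)))]
      (table L (\<lambda>D. min (join (set A) (\<lambda>D. f (insert x D)) g D) (join (set A) f (\<lambda>D. g (insert x D)) D)))
      p" unfolding p_def
    proof (rule runs_POINTMIN)
      fix D assume D: "D \<subseteq> set L"
      then have "join (set A) (\<lambda>D. f (insert x D)) g D \<le> f (insert x D) + g {}"
        by (intro join_le) (auto dest: finite_subset)
      with f[OF D] f[of "{}"] show "join (set A) (\<lambda>D. f (insert x D)) g D \<le> 2 * M" by simp
    qed
    show ?thesis
      unfolding e r_def[symmetric]
      using True
      apply (intro runsI)
       apply (simp_all only: prog_nth JOIN_body_def)
      apply (simp add: t)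
      apply (rule wp_callI[OF runs_MEM_slots[OF x] refl])
      apply simp
      apply (rule wp_callI[OF IH refl], erule f, erule f)
      apply (rule wp_callI[OF IH refl], erule f, erule f)
      apply (rule wp_callI[OF IH refl], erule f, erule f)
      apply (rule wp_callI[OF P refl])
      using c apply simp
      done
  qed
qed

text \<open>Meant for a bag with slots \<open>X\<close> below one with slots \<open>Y\<close>: the
  test selects the edges whose topmost bag is the lower one.\<close>

definition add_set :: "slot set \<Rightarrow> slot set \<Rightarrow> edge \<Rightarrow> (slot set \<Rightarrow> nat) \<Rightarrow> slot set \<Rightarrow> nat" where
  "add_set X Y e f = (if set (cov e) \<subseteq> X \<and> \<not> set (cov e) \<subseteq> Y
    then (\<lambda>D. min (f D) (Suc (f (D - set (cov e))))) else f)"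

lemma runs_ADDSETS:
  assumes "distinct L" "\<And>D. D \<subseteq> set L \<Longrightarrow> f D \<le> k" "\<forall>x\<in>set L. val_size (enc_slot x) \<le> k"
    and "length L \<le> k" "length K \<le> k"
    and "\<forall>e\<in>set es. length (cov e) \<le> k \<and> (\<forall>x\<in>set (cov e). val_size (enc_slot x) \<le> k)"
  shows "runs ADDSETS [enc_list (map enc_edge es), enc_slots L, enc_slots K, table L f]
    (table L (fold (add_set (set L) (set K)) es f))
    ((mem_cost k k + 400) * (4 * k + 10) * 2 ^ length L * (length es + 1))"
  using assms
proof (induction es arbitrary: f)
  case Nil
  show ?case
    apply (rule runsI)
     apply (simp_all add: ADDSETS_body_def)
    apply (rule order_trans[of _ "20 * (1 * 1)"], simp)
    apply (rule order_trans[of _ "(mem_cost k k + 400) * (1 * 1)"], simp)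
    unfolding mult.assoc
    apply (intro mult_le_mono)
    by auto
next
  case (Cons e es)
  define X :: nat where "X = 2 ^ length L"
  have X1: "1 \<le> X" unfolding X_def by simp
  let ?m = "mem_cost k k"
  let ?c = "(?m + 400) * (4 * k + 10)"
  have e: "length (cov e) \<le> k" "\<forall>x\<in>set (cov e). val_size (enc_slot x) \<le> k"
    using Cons.prems by auto
  define b where "b = ?c * X * (length es + 1)"
  define p where "p = (?m + 20) * (k + 1)"
  define a where "a = (?m + 20 * k + 100) * (2 * X)"
  have IH: "runs ADDSETS [enc_list (map enc_edge es), enc_slots L, enc_slots K, table L f']
    (table L (fold (add_set (set L) (set K)) es f')) b"
    if "\<And>D. D \<subseteq> set L \<Longrightarrow> f' D \<le> k" for f'
    unfolding b_def X_def using Cons.prems that by (intro Cons.IH) auto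
  have S: "runs SUBSET [enc_slots (cov e), enc_slots L'] (bval (set (cov e) \<subseteq> set L')) p" if "length L' \<le> k" for L'
    using e that unfolding p_def by (intro runs_mono[OF runs_SUBSET_slots[OF e(2)]] mult_le_mono add_le_mono mem_cost_mono) auto
  have C: "runs COV [enc_edge e] (enc_slots (cov e)) (100 * (k + 1))"
    using e by (intro runs_mono[OF runs_COV]) auto
  have A: "runs ADDSET [enc_slots L, enc_slots (cov e), table L f, table L f]
    (table L (\<lambda>D. min (f D) (Suc (f (D - set (cov e))))))
    a"
    using e tree_count_le[of "length L"] Cons.prems unfolding a_def X_def
    by (intro runs_mono[OF runs_ADDSET[of _ _ k k]] mult_le_mono add_le_mono mem_cost_mono) auto
  define r where "r = ?c * X * (length (e # es) + 1)"
  have c: "2 * p + 3 * (100 * (k + 1)) + a + 200 + b \<le> r"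
  proof -
    define h where "h = 2 * p + 3 * (100 * (k + 1)) + 200"
    define Y where "Y = ?c * X"
    have "h + (?m + 20 * k + 100) * 2 \<le> ?c"
      unfolding h_def p_def by (simp add: algebra_simps)
    then have "(h + (?m + 20 * k + 100) * 2) * X \<le> ?c * X"
      by (rule mult_le_mono1)
    then have "h * X + a \<le> Y"
      unfolding a_def Y_def by (simp only: distrib_right[of h] mult.assoc)
    moreover have "h \<le> h * X"
      using X1 by simp
    moreover have "r = b + Y"
      unfolding r_def b_def Y_def by simp
    ultimately show ?thesis unfolding h_def by linarith
  qed
  have le: "add_set (set L) (set K) e f D \<le> k" if "D \<subseteq> set L" for D
    using Cons.prems(2)[OF that] by (auto simp: add_set_def)
  note SL = S[OF Cons.prems(4)] and SK = S[OF Cons.prems(5)]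
  note IH' = IH[of "add_set (set L) (set K) e f", OF le]
  show ?case
    unfolding X_def[symmetric] r_def[symmetric]
    apply (rule runsI)
     apply (simp)
    apply (simp add: ADDSETS_body_def)
    apply (rule wp_callI[OF C refl])
    apply (rule wp_callI[OF SL refl])
    apply simp
    apply (intro conjI impI)
     apply (rule wp_callI[OF IH'], assumption)
      apply (simp add: add_set_def)
     using c apply simp
    apply (rule wp_callI[OF C refl])
    apply (rule wp_callI[OF SK refl])
    apply simp
    apply (intro conjI impI)
     apply (rule wp_callI[OF C refl])
     apply (rule wp_callI[OF A refl])
     apply (rule wp_callI[OF IH'], assumption)
      apply (simp add: add_set_def)
     using c apply simp
    apply (rule wp_callI[OF IH'], assumption)
     apply (simp add: add_set_def)
    using c apply simp
    done
qed

section \<open>Set cover with penalties: the recurrences behind the table operations\<close>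

section \<open>Covering with penalties\<close>

declare cov.simps [simp del]

definition covered :: "edge set \<Rightarrow> slot set" where
  "covered S = (\<Union>e\<in>S. set (cov e))"

lemma covered_simps [simp]:
  "covered {} = {}" "covered (insert e S) = set (cov e) \<union> covered S"
  "covered (S \<union> S') = covered S \<union> covered S'"
  by (auto simp: covered_def)

lemma covered_mono: "S \<subseteq> S' \<Longrightarrow> covered S \<subseteq> covered S'"
  by (auto simp: covered_def)

definition opt :: "edge set \<Rightarrow> slot set \<Rightarrow> nat" where
  "opt F D = Min ((\<lambda>S. card S + card (D - covered S)) ` Pow F)"

lemma opt_le: "finite F \<Longrightarrow> S \<subseteq> F \<Longrightarrow> opt F D \<le> card S + card (D - covered S)"
  unfolding opt_def by (rule Min_le) auto

lemma opt_attained: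
  assumes "finite F"
  obtains S where "S \<subseteq> F" "opt F D = card S + card (D - covered S)"
proof -
  have "opt F D \<in> (\<lambda>S. card S + card (D - covered S)) ` Pow F"
    unfolding opt_def using assms by (intro Min_in) auto
  then show thesis using that by auto
qed

lemma opt_empty [simp]: "opt {} D = card D"
  by (simp add: opt_def)

lemma opt_le_card: "finite F \<Longrightarrow> opt F D \<le> card D"
  using opt_le[of F "{}" D] by simp

text \<open>A solution either avoids \<open>e\<close>, or takes it at cost 1 and faces only the
  demand that \<open>e\<close> misses. \<open>ADDSET\<close> evaluates this recurrence on a whole
  table.\<close>

lemma opt_insert:
  assumes "finite F" "e \<notin> F"
  shows "opt (insert e F) D = min (opt F D) (Suc (opt F (D - set (cov e))))"
proof (rule antisym)
  obtain S where S: "S \<subseteq> F" "opt F D = card S + card (D - covered S)"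
    by (rule opt_attained[OF assms(1)])
  obtain S' where S': "S' \<subseteq> F"
    "opt F (D - set (cov e)) = card S' + card (D - set (cov e) - covered S')"
    by (rule opt_attained[OF assms(1)])
  have "finite S'" "e \<notin> S'" using S' assms finite_subset by auto
  moreover have "D - set (cov e) - covered S' = D - covered (insert e S')" by auto
  ultimately have "opt (insert e F) D \<le> Suc (opt F (D - set (cov e)))"
    using opt_le[of "insert e F" "insert e S'" D] S' assms by auto
  moreover have "opt (insert e F) D \<le> opt F D"
    using opt_le[of "insert e F" S D] S assms by auto
  ultimately show "opt (insert e F) D \<le> min (opt F D) (Suc (opt F (D - set (cov e))))" by simp
next
  obtain S where S: "S \<subseteq> insert e F" "opt (insert e F) D = card S + card (D - covered S)"
    by (rule opt_attained[of "insert e F"]) (use assms in auto)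
  show "min (opt F D) (Suc (opt F (D - set (cov e)))) \<le> opt (insert e F) D"
  proof (cases "e \<in> S")
    case True
    then obtain S' where S': "S = insert e S'" "e \<notin> S'" by (meson Set.set_insert)
    then have "finite S'" "S' \<subseteq> F" using S assms by (auto dest: finite_subset)
    moreover have "D - covered S = D - set (cov e) - covered S'" using S' by auto
    ultimately have "Suc (opt F (D - set (cov e))) \<le> opt (insert e F) D"
      using opt_le[OF assms(1), of S' "D - set (cov e)"] S S' by simp
    then show ?thesis by simp
  next
    case False
    then have "opt F D \<le> opt (insert e F) D"
      using opt_le[OF assms(1), of S D] S by auto
    then show ?thesis by simp
  qed
qed

text \<open>Distinctness and disjointness make each edge new when its turn comes, as
  \<open>opt_insert\<close> demands.\<close>

lemma fold_add_set:
  assumes "distinct es" "finite F" "set es \<inter> F = {}"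
  shows "fold (add_set X Y) es (opt F) =
    opt (F \<union> {e \<in> set es. set (cov e) \<subseteq> X \<and> \<not> set (cov e) \<subseteq> Y})"
  using assms
proof (induction es arbitrary: F)
  case (Cons e es)
  let ?F = "if set (cov e) \<subseteq> X \<and> \<not> set (cov e) \<subseteq> Y then insert e F else F"
  have "add_set X Y e (opt F) = opt ?F"
    using Cons.prems by (auto simp: add_set_def opt_insert)
  moreover have "fold (add_set X Y) es (opt ?F) =
    opt (?F \<union> {e \<in> set es. set (cov e) \<subseteq> X \<and> \<not> set (cov e) \<subseteq> Y})"
    using Cons.prems by (intro Cons.IH) auto
  moreover have "?F \<union> {e \<in> set es. set (cov e) \<subseteq> X \<and> \<not> set (cov e) \<subseteq> Y} =
    F \<union> {e' \<in> set (e # es). set (cov e') \<subseteq> X \<and> \<not> set (cov e') \<subseteq> Y}"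
    by auto
  ultimately show ?case by simp
qed simp

text \<open>Optimal solutions of the two parts are merged; overlaps only lower the cost.\<close>

lemma opt_Un_le:
  assumes "finite F1" "finite F2" "finite D1" "finite D2"
  shows "opt (F1 \<union> F2) (D1 \<union> D2) \<le> opt F1 D1 + opt F2 D2"
proof -
  obtain S1 where S1: "S1 \<subseteq> F1" "opt F1 D1 = card S1 + card (D1 - covered S1)"
    by (rule opt_attained[OF assms(1)])
  obtain S2 where S2: "S2 \<subseteq> F2" "opt F2 D2 = card S2 + card (D2 - covered S2)"
    by (rule opt_attained[OF assms(2)])
  have "card (D1 \<union> D2 - covered (S1 \<union> S2)) \<le> card ((D1 - covered S1) \<union> (D2 - covered S2))"
    using assms by (intro card_mono) auto
  also have "\<dots> \<le> card (D1 - covered S1) + card (D2 - covered S2)" by (rule card_Un_le)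
  finally have "card (D1 \<union> D2 - covered (S1 \<union> S2)) \<le> \<dots>" .
  moreover have "card (S1 \<union> S2) \<le> card S1 + card S2" by (rule card_Un_le)
  moreover have "opt (F1 \<union> F2) (D1 \<union> D2) \<le> card (S1 \<union> S2) + card (D1 \<union> D2 - covered (S1 \<union> S2))"
    using assms S1 S2 by (intro opt_le) auto
  ultimately show ?thesis using S1 S2 by linarith
qed

text \<open>A cover by \<open>F1 \<union> F2\<close> splits the demand \<open>D\<close> on the separator into the part \<open>B\<close> met by
  \<open>F2\<close> and the rest, which is left to \<open>F1\<close>.\<close>

lemma opt_join:
  assumes fin: "finite F1" "finite F2" "finite D" "finite Q1" "finite Q2"
    and D: "D \<inter> Q1 = {}" "D \<inter> Q2 = {}" and Q: "Q1 \<inter> Q2 = {}" and F: "F1 \<inter> F2 = {}"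
    and cov1: "covered F1 \<inter> Q2 = {}"
    and cov2: "covered F2 \<inter> (D \<union> Q1) \<subseteq> A"
    and A: "A \<inter> Q1 = {}"
  shows "opt (F1 \<union> F2) (D \<union> (Q1 \<union> Q2)) =
    join A (\<lambda>D. opt F1 (D \<union> Q1)) (\<lambda>D. opt F2 (D \<union> Q2)) D"
proof (rule antisym)
  let ?h = "\<lambda>B. opt F1 (D - B \<union> Q1) + opt F2 (B \<union> Q2)"
  have "opt (F1 \<union> F2) (D \<union> (Q1 \<union> Q2)) \<le> ?h B" if "B \<subseteq> D \<inter> A" for B
  proof -
    have "D \<union> (Q1 \<union> Q2) = (D - B \<union> Q1) \<union> (B \<union> Q2)" using that by auto
    moreover have "finite B" using that fin by (auto dest: finite_subset)
    ultimately show ?thesis using opt_Un_le[of F1 F2 "D - B \<union> Q1" "B \<union> Q2"] fin by simp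
  qed
  then show "opt (F1 \<union> F2) (D \<union> (Q1 \<union> Q2)) \<le>
      join A (\<lambda>D. opt F1 (D \<union> Q1)) (\<lambda>D. opt F2 (D \<union> Q2)) D"
    unfolding join_def using fin by (subst Min_ge_iff) auto
next
  let ?h = "\<lambda>B. opt F1 (D - B \<union> Q1) + opt F2 (B \<union> Q2)"
  obtain S where S: "S \<subseteq> F1 \<union> F2"
    "opt (F1 \<union> F2) (D \<union> (Q1 \<union> Q2)) = card S + card (D \<union> (Q1 \<union> Q2) - covered S)"
    by (rule opt_attained[of "F1 \<union> F2"]) (use fin in auto)
  define S1 S2 where "S1 = S \<inter> F1" and "S2 = S \<inter> F2"
  have S12: "S = S1 \<union> S2" "S1 \<inter> S2 = {}" "S1 \<subseteq> F1" "S2 \<subseteq> F2"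
    using S F unfolding S1_def S2_def by auto
  have fS: "finite S1" "finite S2" using S12 fin by (auto dest: finite_subset)
  have c1: "covered S1 \<subseteq> covered F1" "covered S2 \<subseteq> covered F2"
    using S12 by (auto intro!: covered_mono)
  \<comment> \<open>Among the splits that \<open>join\<close> tries, the one matching
    \<open>S\<close> hands over exactly the demand that \<open>S2\<close> meets.\<close>
  define B where "B = D \<inter> A \<inter> covered S2"
  have "join A (\<lambda>D. opt F1 (D \<union> Q1)) (\<lambda>D. opt F2 (D \<union> Q2)) D \<le> ?h B"
    unfolding join_def using fin by (intro Min_le) (auto simp: B_def)
  also have "\<dots> \<le> (card S1 + card (D - B \<union> Q1 - covered S1)) + (card S2 + card (B \<union> Q2 - covered S2))"
    using S12 fin by (intro add_mono opt_le) auto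
  also have "\<dots> = card S + card ((D - B \<union> Q1 - covered S1) \<union> (B \<union> Q2 - covered S2))"
  proof -
    have "(D - B \<union> Q1 - covered S1) \<inter> (B \<union> Q2 - covered S2) = {}"
      using D Q unfolding B_def by auto
    then show ?thesis
      using S12 fS fin by (subst card_Un_disjoint[where A = "D - B \<union> Q1 - covered S1"])
        (auto simp: card_Un_disjoint B_def)
  qed
  \<comment> \<open>What one side leaves uncovered is not covered by the other: \<open>F1\<close>
    misses \<open>Q2\<close>, and \<open>F2\<close> meets \<open>D\<close> and \<open>Q1\<close>
    only in \<open>A\<close>, where \<open>B\<close> has absorbed what \<open>S2\<close>
    covers.\<close>
  also have "(D - B \<union> Q1 - covered S1) \<union> (B \<union> Q2 - covered S2) = D \<union> (Q1 \<union> Q2) - covered S"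
    using c1 cov1 cov2 D Q A unfolding S12(1) B_def by auto
  finally show "join A (\<lambda>D. opt F1 (D \<union> Q1)) (\<lambda>D. opt F2 (D \<union> Q2)) D
      \<le> opt (F1 \<union> F2) (D \<union> (Q1 \<union> Q2))"
    using S by simp
qed

section \<open>The invariant of the traversal and the cost of a subtree\<close>

section \<open>Traversal of the decomposition\<close>

lemma length_le_val_size: "length xs \<le> val_size (enc_list xs)"
  by (induction xs) auto

lemma val_size_mem: "x \<in> set xs \<Longrightarrow> val_size x \<le> val_size (enc_list xs)"
  by (induction xs) auto

primrec bags :: "bag_tree \<Rightarrow> nat set set" where
  "bags (Node b ts) = insert (set b) (\<Union>(set (map bags ts)))"

definition verts :: "bag_tree \<Rightarrow> nat set" where
  "verts T = \<Union>(bags T)"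

lemma verts_Node: "verts (Node b ts) = set b \<union> (\<Union>t\<in>set ts. verts t)"
  by (auto simp: verts_def)

text \<open>The running intersection property in local, rooted form. As the relation is symmetric,
  \<open>sorted_wrt\<close> just says that it holds pairwise; \<open>list_all\<close> over a
  \<open>map\<close> keeps the recursion primitive.\<close>

primrec coherent :: "bag_tree \<Rightarrow> bool" where
  "coherent (Node b ts) \<longleftrightarrow> list_all (\<lambda>x. x) (map coherent ts) \<and>
     (\<forall>t\<in>set ts. verts t \<inter> set b \<subseteq> set (root_bag t)) \<and>
     sorted_wrt (\<lambda>s t. verts s \<inter> verts t \<subseteq> set b) ts"

text \<open>\<open>k\<close> bounds the polynomial quantities and \<open>G\<close> the exponential
  ones. \<open>width1\<close> pays for the table of a bag, \<open>width2\<close> for joining a bag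
  \<open>X\<close> to a bag \<open>Y\<close>; its premise excludes the children that are
  skipped.\<close>

locale instance_bounds =
  fixes es :: "edge list" and U :: "slot list" and k G :: nat and BB :: "nat set set"
  assumes distinct_U: "distinct U" and length_U: "length U \<le> k"
    and size_U: "\<forall>x\<in>set U. val_size (enc_slot x) \<le> k"
    and distinct_es: "distinct es" and length_es: "length es \<le> k"
    and cov_es: "\<forall>e\<in>set es. length (cov e) \<le> k \<and> set (cov e) \<subseteq> set U"
    and width1: "\<And>X. X \<in> BB \<Longrightarrow> 2 ^ card (set (slots_in X U)) \<le> G"
    and width2: "\<And>X Y. X \<in> BB \<Longrightarrow> Y \<in> BB \<Longrightarrow> \<not> set (slots_in X U) \<subseteq> set (slots_in Y U) \<Longrightarrow>
      2 ^ (card (set (slots_in Y U)) + card (set (slots_in X U) \<inter> set (slots_in Y U))) \<le> G"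
    and G: "1 \<le> G"
begin

abbreviation sl :: "nat set \<Rightarrow> slot set" where
  "sl X \<equiv> set (slots_in X U)"

lemma sl_def: "sl X = {s \<in> set U. fst s \<in> X}"
  by (auto simp: slots_in_def)

definition edges_of :: "nat set set \<Rightarrow> slot set \<Rightarrow> edge set" where
  "edges_of Bs Y = {e \<in> set es. (\<exists>X\<in>Bs. set (cov e) \<subseteq> sl X) \<and> \<not> set (cov e) \<subseteq> Y}"

text \<open>The state at a bag with slots \<open>L\<close>: \<open>F\<close> are the edges used so
  far and \<open>Q\<close> the finished slots, which are demanded for good. Used edges touch no
  other slots.\<close>

definition ctx :: "slot list \<Rightarrow> edge set \<Rightarrow> slot set \<Rightarrow> bool" where
  "ctx L F Q \<longleftrightarrow> distinct L \<and> (\<exists>B\<in>BB. set L = sl B) \<and> F \<subseteq> set es \<and>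
     covered F \<subseteq> set L \<union> Q \<and> Q \<inter> set L = {} \<and> Q \<subseteq> set U"

definition unit_cost :: nat where
  "unit_cost = (mem_cost k k + 400) * (4 * k + 10) * (k + 1) * G"

abbreviation enc_es :: val where
  "enc_es \<equiv> enc_list (map enc_edge es)"

abbreviation tree_cost :: "bag_tree \<Rightarrow> nat" where
  "tree_cost T \<equiv> 20 * unit_cost * val_size (enc_bag_tree T)"

text \<open>After skips, \<open>L\<close> belongs to a bag above the parent of \<open>T\<close>. So
  it is only asked that the subtree meets \<open>L\<close> inside its root bag and avoids the
  finished slots, which skipping preserves.\<close>

definition proc_ok :: "bag_tree \<Rightarrow> bool" where
  "proc_ok T \<longleftrightarrow> (\<forall>L F Q. ctx L F Q \<longrightarrow> sl (verts T) \<inter> set L \<subseteq> sl (set (root_bag T)) \<longrightarrow>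
     sl (verts T) \<inter> Q = {} \<longrightarrow>
     runs PROC [enc_bag_tree T, enc_es, enc_slots U, enc_slots L, table L (\<lambda>D. opt F (D \<union> Q))]
       (table L (\<lambda>D. opt (F \<union> edges_of (bags T) (set L)) (D \<union> (Q \<union> (sl (verts T) - set L)))))
       (tree_cost T))"

lemma proc_okD:
  "proc_ok T \<Longrightarrow> ctx L F Q \<Longrightarrow> sl (verts T) \<inter> set L \<subseteq> sl (set (root_bag T)) \<Longrightarrow>
    sl (verts T) \<inter> Q = {} \<Longrightarrow>
    runs PROC [enc_bag_tree T, enc_es, enc_slots U, enc_slots L, table L (\<lambda>D. opt F (D \<union> Q))]
      (table L (\<lambda>D. opt (F \<union> edges_of (bags T) (set L)) (D \<union> (Q \<union> (sl (verts T) - set L)))))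
      (tree_cost T)"
  unfolding proc_ok_def by blast

lemma covered_edges_of: "covered (edges_of Bs Y) \<subseteq> sl (\<Union>Bs)"
  by (auto simp: covered_def edges_of_def sl_def)

lemma ctx_finite: "ctx L F Q \<Longrightarrow> finite F \<and> finite Q"
  unfolding ctx_def by (auto dest: finite_subset)

lemma ctx_step:
  assumes "ctx L F Q"
  shows "ctx L (F \<union> edges_of Bs (set L)) (Q \<union> (sl (\<Union>Bs) - set L))"
  using assms covered_edges_of[of Bs "set L"] unfolding ctx_def
  by (auto simp: edges_of_def sl_def)

lemma unit_cost_bounds:
  "400 \<le> unit_cost"
  "(mem_cost k k + 30) * (k + 1) \<le> unit_cost"
  "20 * (k + 1) \<le> unit_cost"
  "40 * G \<le> unit_cost"
  "(mem_cost k k + 400) * (4 * k + 10) * G * (k + 1) \<le> unit_cost"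
  "(mem_cost k k + 40 * k + 200) * (k + 1) * G \<le> unit_cost"
proof -
  let ?m = "mem_cost k k"
  have u: "a * b * c * d \<le> unit_cost"
    if "a \<le> ?m + 400" "b \<le> 4 * k + 10" "c \<le> k + 1" "d \<le> G" for a b c d
    unfolding unit_cost_def using that by (intro mult_le_mono)
  show "400 \<le> unit_cost" using u[of 400 1 1 1] G by simp
  show "(?m + 30) * (k + 1) \<le> unit_cost" using u[of "?m + 30" 1 "k + 1" 1] G by simp
  show "20 * (k + 1) \<le> unit_cost" using u[of 20 1 "k + 1" 1] G by simp
  show "40 * G \<le> unit_cost" using u[of 40 1 1 G] by simp
  show "(?m + 400) * (4 * k + 10) * G * (k + 1) \<le> unit_cost"
    unfolding unit_cost_def by (simp only: mult.assoc mult.commute[of G] order_refl)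
  have "?m + 40 * k + 200 \<le> (?m + 400) * (4 * k + 10)" by (simp add: algebra_simps)
  then show "(?m + 40 * k + 200) * (k + 1) * G \<le> unit_cost"
    unfolding unit_cost_def by (intro mult_le_mono) auto
qed

text \<open>The slots of one child outside \<open>L\<close> are finished before the next child is
  processed. Siblings meet only in \<open>L\<close>, so the next subtree still avoids
  \<open>Q\<close>.\<close>

lemma runs_FOLD:
  assumes "\<forall>t\<in>set ts. proc_ok t" "ctx L F Q"
    and "\<forall>t\<in>set ts. sl (verts t) \<inter> set L \<subseteq> sl (set (root_bag t)) \<and> sl (verts t) \<inter> Q = {}"
    and "sorted_wrt (\<lambda>s t. sl (verts s) \<inter> sl (verts t) \<subseteq> set L) ts"
  shows "runs FOLD [enc_list (map enc_bag_tree ts), enc_es, enc_slots U, enc_slots L,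
      table L (\<lambda>D. opt F (D \<union> Q))]
    (table L (\<lambda>D. opt (F \<union> edges_of (\<Union>(bags ` set ts)) (set L))
       (D \<union> (Q \<union> (sl (\<Union>(verts ` set ts)) - set L)))))
    (20 * unit_cost * val_size (enc_list (map enc_bag_tree ts)))"
  using assms
proof (induction ts arbitrary: F Q)
  case Nil
  have "edges_of {} (set L) = {}" "sl {} = {}" by (auto simp: edges_of_def sl_def)
  then show ?case
    using unit_cost_bounds(1) by (intro runsI) (auto simp: FOLD_body_def)
next
  case (Cons t ts)
  let ?F = "F \<union> edges_of (bags t) (set L)" and ?Q = "Q \<union> (sl (verts t) - set L)"
  have t: "runs PROC [enc_bag_tree t, enc_es, enc_slots U, enc_slots L, table L (\<lambda>D. opt F (D \<union> Q))]
     (table L (\<lambda>D. opt ?F (D \<union> ?Q))) (tree_cost t)"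
    using Cons.prems by (intro proc_okD) auto
  have F: "?F \<union> edges_of (\<Union>(bags ` set ts)) (set L) = F \<union> edges_of (\<Union>(bags ` set (t # ts))) (set L)"
    by (auto simp: edges_of_def)
  have Q: "?Q \<union> (sl (\<Union>(verts ` set ts)) - set L) = Q \<union> (sl (\<Union>(verts ` set (t # ts))) - set L)"
    by (auto simp: sl_def)
  have ts: "runs FOLD [enc_list (map enc_bag_tree ts), enc_es, enc_slots U, enc_slots L,
      table L (\<lambda>D. opt ?F (D \<union> ?Q))]
    (table L (\<lambda>D. opt (?F \<union> edges_of (\<Union>(bags ` set ts)) (set L))
       (D \<union> (?Q \<union> (sl (\<Union>(verts ` set ts)) - set L)))))
    (20 * unit_cost * val_size (enc_list (map enc_bag_tree ts)))"
  proof (rule Cons.IH)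
    show "ctx L ?F ?Q" using ctx_step[OF Cons.prems(2), of "bags t"] by (simp add: verts_def)
    show "\<forall>t'\<in>set ts. sl (verts t') \<inter> set L \<subseteq> sl (set (root_bag t')) \<and> sl (verts t') \<inter> ?Q = {}"
      using Cons.prems(3,4) by auto
  qed (use Cons.prems in auto)
  show ?case
    apply (rule runsI)
     apply (simp)
    apply (simp add: FOLD_body_def)
    apply (rule wp_callI[OF t refl])
    apply (rule wp_callI[OF ts refl])
    using unit_cost_bounds(1) unfolding F Q apply (simp add: algebra_simps)
    done
qed

text \<open>For want of local bindings, the new slots arrive as an argument. Of the 15 units, 11 pay
  for the calls other than \<open>FOLD\<close>, the rest for the overhead of the body.\<close>

lemma runs_PROCNEW:
  assumes ctx: "ctx L F Q" and ok: "\<forall>t\<in>set ts. proc_ok t" and T: "T = Node b ts"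
    and coh: "coherent T" and b: "set b \<in> BB" "length b \<le> k"
    and root: "sl (verts T) \<inter> set L \<subseteq> sl (set b)" and Q: "sl (verts T) \<inter> Q = {}"
  shows "runs PROCNEW [enc_bag_tree T, enc_es, enc_slots U, enc_slots L, table L (\<lambda>D. opt F (D \<union> Q)),
      enc_slots (filter (\<lambda>x. x \<notin> set L) (slots_in (set b) U))]
     (table L (\<lambda>D. opt (F \<union> edges_of (bags T) (set L)) (D \<union> (Q \<union> (sl (verts T) - set L)))))
     (15 * unit_cost + 20 * unit_cost * val_size (enc_list (map enc_bag_tree ts)))"
proof -
  define LN where "LN = filter (\<lambda>x. x \<notin> set L) (slots_in (set b) U)"
  have L: "distinct L" "set L \<subseteq> set U" and Q': "Q \<inter> set L = {}" "Q \<subseteq> set U"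
    and F: "F \<subseteq> set es" "covered F \<subseteq> set L \<union> Q" and fin: "finite F" "finite Q"
    using ctx ctx_finite[OF ctx] unfolding ctx_def by (auto simp: sl_def)
  have LN: "set LN = sl (set b) - set L" "distinct LN"
    unfolding LN_def using distinct_U by (auto simp: slots_in_def)
  have vT: "sl (verts T) = sl (set b) \<union> sl (\<Union>(verts ` set ts))"
    unfolding T verts_Node by (auto simp: sl_def)
  have coh1: "sl (verts t) \<inter> sl (set b) \<subseteq> sl (set (root_bag t))" if "t \<in> set ts" for t
    using coh that unfolding T by (auto simp: sl_def)
  have coh2: "sorted_wrt (\<lambda>s t. sl (verts s) \<inter> sl (verts t) \<subseteq> sl (set b)) ts"
    by (rule sorted_wrt_mono_rel[of _ "\<lambda>s t. verts s \<inter> verts t \<subseteq> set b"])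
      (use coh in \<open>auto simp: T sl_def\<close>)
  note u = unit_cost_bounds
  have card_le: "card X \<le> k" if "X \<subseteq> set U" for X
    using card_mono[OF finite_set that] distinct_card[OF distinct_U] length_U by simp
  show ?thesis
  proof (cases "LN = []")
    case True
    then have bL: "sl (set b) \<subseteq> set L" using LN by simp
    have F': "F \<union> edges_of (\<Union>(bags ` set ts)) (set L) = F \<union> edges_of (bags T) (set L)"
      using bL by (auto simp: edges_of_def T)
    have Q'': "sl (\<Union>(verts ` set ts)) - set L = sl (verts T) - set L"
      using bL unfolding vT by auto
    have FOLD: "runs FOLD [enc_list (map enc_bag_tree ts), enc_es, enc_slots U, enc_slots L,
        table L (\<lambda>D. opt F (D \<union> Q))]
      (table L (\<lambda>D. opt (F \<union> edges_of (bags T) (set L))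
        (D \<union> (Q \<union> (sl (verts T) - set L)))))
      (20 * unit_cost * val_size (enc_list (map enc_bag_tree ts)))"
      unfolding F'[symmetric] Q''[symmetric]
    proof (rule runs_FOLD[OF ok ctx])
      show "\<forall>t\<in>set ts. sl (verts t) \<inter> set L \<subseteq> sl (set (root_bag t)) \<and> sl (verts t) \<inter> Q = {}"
      proof (intro ballI conjI)
        fix t assume t: "t \<in> set ts"
        then have "sl (verts t) \<subseteq> sl (verts T)" unfolding vT by (auto simp: sl_def)
        \<comment> \<open>By \<open>root\<close> the subtree of \<open>t\<close> meets
          \<open>L\<close> only inside the skipped bag, and by \<open>coh1\<close> it meets that bag
          only inside its own root bag.\<close>
        then show "sl (verts t) \<inter> set L \<subseteq> sl (set (root_bag t))" "sl (verts t) \<inter> Q = {}"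
          using root Q coh1[OF t] by auto
      qed
      show "sorted_wrt (\<lambda>s t. sl (verts s) \<inter> sl (verts t) \<subseteq> set L) ts"
        by (rule sorted_wrt_mono_rel[OF _ coh2]) (use bL in auto)
    qed
    show ?thesis
      unfolding LN_def[symmetric] True
      apply (rule runsI)
       apply simp
      apply (simp add: PROCNEW_body_def)
      apply (simp only: T enc_bag_tree.simps val_snd.simps)
      apply (rule wp_callI[OF FOLD[unfolded T] refl])
      using u(1) apply simp
      done
  next
    case False
    define LA where "LA = slots_in (set b) L"
    define L' where "L' = LN @ LA"
    define F0 where "F0 = {e \<in> set es. set (cov e) \<subseteq> set L' \<and> \<not> set (cov e) \<subseteq> set L}"
    define F2 where "F2 = edges_of (bags T) (set L)"
    define Q2 where "Q2 = sl (verts T) - set L"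
    have LA: "set LA = sl (set b) \<inter> set L" "distinct LA"
      unfolding LA_def using L by (auto simp: slots_in_def)
    have LA': "filter (\<lambda>x. x \<in> set LA) L = LA"
      using L unfolding LA_def slots_in_def by (auto intro: filter_cong)
    have L': "set L' = sl (set b)" "distinct L'"
      unfolding L'_def using LN LA by auto
    have lenL': "length L' = card (sl (set b))"
      using distinct_card[OF L'(2)] L' by simp
    have len_le: "length X \<le> k" if "distinct X" "set X \<subseteq> set U" for X :: "slot list"
      using card_le[OF that(2)] distinct_card[OF that(1)] by simp
    have len: "length L' \<le> k" "length LN \<le> k" "length LA \<le> k" "length L \<le> k"
      using L LN LA L' by (auto intro!: len_le simp: sl_def)
    have GL': "2 ^ length L' \<le> G" unfolding lenL' by (rule width1[OF b(1)])
    \<comment> \<open>A new slot exists, so the slots of this bag are not contained in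
      \<open>L\<close> and \<open>width2\<close> applies.\<close>
    have GL: "2 ^ (length L + length LA) \<le> G"
    proof -
      obtain B where B: "B \<in> BB" "set L = sl B" using ctx unfolding ctx_def by auto
      have "set LN \<noteq> {}" using False by simp
      then have "\<not> sl (set b) \<subseteq> sl B" using LN B by auto
      from width2[OF b(1) B(1) this] show ?thesis
        using distinct_card[OF L(1)] distinct_card[OF LA(2)] LA B by simp
    qed
    have sizes: "\<forall>x\<in>set L. val_size (enc_slot x) \<le> k" "\<forall>x\<in>set L'. val_size (enc_slot x) \<le> k"
      using size_U L L' by (auto simp: sl_def)
    have fin2: "finite F0" "finite F2" "finite Q2"
      by (auto simp: F0_def F2_def edges_of_def Q2_def)
    have SLOTS: "runs SLOTS [enc_slots L, enc_list (map enc_nat b)] (enc_slots LA) unit_cost"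
      unfolding LA_def using len b
      by (intro runs_mono[OF runs_SLOTS[OF sizes(1)] order_trans[OF _ u(2)]] mult_le_mono add_le_mono
          mem_cost_mono) auto
    have APPEND: "runs APPEND [enc_slots LN, enc_slots LA] (enc_slots L') unit_cost"
      unfolding L'_def using len
      by (intro runs_mono[OF runs_APPEND_slots order_trans[OF _ u(3)]]) auto
    have BASE: "runs BASE [enc_slots L', Null] (table L' (opt {})) unit_cost"
    proof -
      have "runs BASE [enc_slots L', Null] (table L' (opt {})) (20 * tree_count (length L'))"
        using runs_BASE[OF L'(2), of 0] by (simp flip: opt_empty)
      moreover have "20 * tree_count (length L') \<le> unit_cost"
        using tree_count_le[of "length L'"] GL' u(4) by linarith
      ultimately show ?thesis by (rule runs_mono)
    qed
    have ADDSETS: "runs ADDSETS [enc_es, enc_slots L', enc_slots L, table L' (opt {})]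
      (table L' (opt F0)) unit_cost"
    proof -
      have "runs ADDSETS [enc_es, enc_slots L', enc_slots L, table L' (opt {})]
       (table L' (fold (add_set (set L') (set L)) es (opt {})))
       ((mem_cost k k + 400) * (4 * k + 10) * 2 ^ length L' * (length es + 1))"
      proof (rule runs_ADDSETS)
        show "\<forall>e\<in>set es. length (cov e) \<le> k \<and> (\<forall>x\<in>set (cov e). val_size (enc_slot x) \<le> k)"
          using cov_es size_U by blast
      qed (use L' sizes len in \<open>auto simp: sl_def intro: card_le\<close>)
      moreover have "fold (add_set (set L') (set L)) es (opt {}) = opt F0"
        using fold_add_set[OF distinct_es, of "{}" "set L'" "set L"] by (simp add: F0_def)
      moreover have "(mem_cost k k + 400) * (4 * k + 10) * 2 ^ length L' * (length es + 1) \<le> unit_cost"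
        using GL' length_es by (intro order_trans[OF _ u(5)] mult_le_mono) auto
      ultimately show ?thesis by (auto intro: runs_mono)
    qed
    have ctx': "ctx L' F0 {}"
      unfolding ctx_def using L' b by (auto simp: F0_def covered_def)
    have FOLD: "runs FOLD [enc_list (map enc_bag_tree ts), enc_es, enc_slots U, enc_slots L',
        table L' (opt F0)]
      (table L' (\<lambda>D. opt (F0 \<union> edges_of (\<Union>(bags ` set ts)) (set L'))
        (D \<union> (sl (\<Union>(verts ` set ts)) - set L'))))
      (20 * unit_cost * val_size (enc_list (map enc_bag_tree ts)))"
      using runs_FOLD[OF ok ctx'] coh1 coh2 L'(1) by simp
    have F0: "F0 \<union> edges_of (\<Union>(bags ` set ts)) (set L') = F2"
    proof -
      \<comment> \<open>By \<open>root\<close>, an edge from below with all its slots in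
        \<open>L\<close> would have them in this bag too; excluding edges inside \<open>L'\<close>
        thus excludes those inside \<open>L\<close>.\<close>
      have out: "\<not> set (cov e) \<subseteq> set L"
        if e: "e \<in> edges_of (\<Union>(bags ` set ts)) (set L')" for e
      proof
        assume "set (cov e) \<subseteq> set L"
        moreover have "set (cov e) \<subseteq> sl (verts T)"
          using e unfolding vT by (auto simp: edges_of_def sl_def verts_def)
        ultimately have "set (cov e) \<subseteq> set L'" using root L' by auto
        with e show False by (auto simp: edges_of_def)
      qed
      show ?thesis
      proof (rule set_eqI)
        fix e
        let ?B = "\<exists>X\<in>\<Union>(bags ` set ts). set (cov e) \<subseteq> sl X"
        have "e \<in> F0 \<longleftrightarrow> e \<in> set es \<and> set (cov e) \<subseteq> sl (set b) \<and> \<not> set (cov e) \<subseteq> set L"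
          unfolding F0_def L'(1) by simp
        moreover have "e \<in> edges_of (\<Union>(bags ` set ts)) (set L') \<longleftrightarrow>
            e \<in> set es \<and> ?B \<and> \<not> set (cov e) \<subseteq> sl (set b)"
          unfolding edges_of_def L'(1) by simp
        moreover have "e \<in> F2 \<longleftrightarrow>
            e \<in> set es \<and> (set (cov e) \<subseteq> sl (set b) \<or> ?B) \<and> \<not> set (cov e) \<subseteq> set L"
          unfolding F2_def T edges_of_def by simp
        ultimately show "e \<in> F0 \<union> edges_of (\<Union>(bags ` set ts)) (set L') \<longleftrightarrow> e \<in> F2"
          using out[of e] by blast
      qed
    qed
    have DOWN: "runs DOWN [enc_slots LN, table L' (\<lambda>D. opt (F0 \<union> edges_of (\<Union>(bags ` set ts)) (set L'))
        (D \<union> (sl (\<Union>(verts ` set ts)) - set L')))]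
      (table LA (\<lambda>D. opt F2 (D \<union> Q2))) unit_cost"
    proof -
      \<comment> \<open>Slots of the subtree that occur in \<open>L\<close> occur in this bag, by
        \<open>root\<close>. So removing \<open>L'\<close> below and demanding \<open>LN\<close>
        amounts to removing \<open>L\<close>.\<close>
      have "set LN \<union> D \<union> (sl (\<Union>(verts ` set ts)) - set L') = D \<union> Q2" if "D \<subseteq> set LA" for D
        using that root unfolding Q2_def vT LN L' LA by auto
      then have "table LA (\<lambda>D. opt F2 (set LN \<union> D \<union> (sl (\<Union>(verts ` set ts)) - set L'))) =
          table LA (\<lambda>D. opt F2 (D \<union> Q2))"
        by (intro table_cong) auto
      then show ?thesis
        unfolding F0 using len runs_DOWN[of LN LA "\<lambda>D. opt F2 (D \<union> (sl (\<Union>(verts ` set ts)) - set L'))"]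
        by (auto simp: L'_def elim!: runs_mono intro!: order_trans[OF _ u(3)])
    qed
    have opt_k: "opt F' D \<le> k" if "finite F'" "D \<subseteq> set U" for F' D
      using opt_le_card[OF that(1)] card_le[OF that(2)] le_trans by blast
    have JOIN: "runs JOIN [enc_slots L, enc_slots LA, table L (\<lambda>D. opt F (D \<union> Q)),
        table LA (\<lambda>D. opt F2 (D \<union> Q2))]
      (table L (\<lambda>D. opt (F \<union> F2) (D \<union> (Q \<union> Q2)))) unit_cost"
    proof -
      have cov2: "covered F2 \<subseteq> sl (verts T)"
        using covered_edges_of[of "bags T"] unfolding F2_def verts_def by blast
      \<comment> \<open>A common edge would have its slots in \<open>L\<close> or \<open>Q\<close>
        and also in the subtree, which avoids \<open>Q\<close>; so all would lie in
        \<open>L\<close>, contrary to the choice of \<open>F2\<close>.\<close>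
      have disj: "F \<inter> F2 = {}"
      proof -
        have "e \<notin> F2" if e: "e \<in> F" for e
        proof
          assume e2: "e \<in> F2"
          then have "set (cov e) \<subseteq> sl (verts T)" "\<not> set (cov e) \<subseteq> set L"
            using cov2 by (auto simp: covered_def F2_def edges_of_def)
          moreover have "set (cov e) \<subseteq> set L \<union> Q" using e F by (auto simp: covered_def)
          ultimately show False using Q by auto
        qed
        then show ?thesis by auto
      qed
      have eq: "join (set LA) (\<lambda>D. opt F (D \<union> Q)) (\<lambda>D. opt F2 (D \<union> Q2)) D =
          opt (F \<union> F2) (D \<union> (Q \<union> Q2))" if D: "D \<subseteq> set L" for D
      proof (rule opt_join[symmetric])
        show "covered F \<inter> Q2 = {}" using F(2) Q unfolding Q2_def by auto
        show "covered F2 \<inter> (D \<union> Q) \<subseteq> set LA" using cov2 D Q root unfolding LA by auto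
        show "Q \<inter> Q2 = {}" "D \<inter> Q2 = {}" "D \<inter> Q = {}" using Q Q' D unfolding Q2_def by auto
        show "set LA \<inter> Q = {}" using Q' LA by auto
        show "finite D" using D finite_subset by auto
      qed (use fin fin2 disj in auto)
      have cost: "(mem_cost k (length LA) + 40 * k + 200) * (length L + 1) * 2 ^ (length L + length LA)
          \<le> unit_cost"
        using len GL by (intro order_trans[OF _ u(6)] mult_le_mono add_le_mono mem_cost_mono) auto
      have Q2U: "Q2 \<subseteq> set U" by (auto simp: Q2_def sl_def)
      have "runs JOIN [enc_slots L, enc_slots LA, table L (\<lambda>D. opt F (D \<union> Q)),
          table (filter (\<lambda>x. x \<in> set LA) L) (\<lambda>D. opt F2 (D \<union> Q2))]
        (table L (join (set LA) (\<lambda>D. opt F (D \<union> Q)) (\<lambda>D. opt F2 (D \<union> Q2))))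
        ((mem_cost k (length LA) + 40 * k + 200) * (length L + 1) *
          2 ^ (length L + length (filter (\<lambda>x. x \<in> set LA) L)))"
        by (rule runs_JOIN[OF L(1) sizes(1)]; rule opt_k) (use fin fin2 L Q' Q2U in auto)
      then have "runs JOIN [enc_slots L, enc_slots LA, table L (\<lambda>D. opt F (D \<union> Q)),
          table LA (\<lambda>D. opt F2 (D \<union> Q2))]
        (table L (join (set LA) (\<lambda>D. opt F (D \<union> Q)) (\<lambda>D. opt F2 (D \<union> Q2)))) unit_cost"
        unfolding LA' by (rule runs_mono[OF _ cost])
      also have "table L (join (set LA) (\<lambda>D. opt F (D \<union> Q)) (\<lambda>D. opt F2 (D \<union> Q2))) =
          table L (\<lambda>D. opt (F \<union> F2) (D \<union> (Q \<union> Q2)))"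
        by (rule table_cong) (rule eq)
      finally show ?thesis .
    qed
    have ne: "enc_slots LN \<noteq> Null" using False by (cases LN) auto
    have T': "val_fst (enc_bag_tree T) = enc_list (map enc_nat b)"
      "val_snd (enc_bag_tree T) = enc_list (map enc_bag_tree ts)"
      unfolding T by auto
    show ?thesis
      unfolding LN_def[symmetric] F2_def[symmetric] Q2_def[symmetric]
      apply (rule runsI)
       apply simp
      apply (simp add: PROCNEW_body_def ne T')
      apply (rule wp_callI[OF SLOTS refl])
      apply (rule wp_callI[OF SLOTS refl])
      apply (rule wp_callI[OF APPEND refl])
      apply (rule wp_callI[OF SLOTS refl])
      apply (rule wp_callI[OF APPEND refl])
      apply (rule wp_callI[OF SLOTS refl])
      apply (rule wp_callI[OF APPEND refl])
      apply (rule wp_callI[OF BASE refl])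
      apply (rule wp_callI[OF ADDSETS refl])
      apply (rule wp_callI[OF FOLD refl])
      apply (rule wp_callI[OF DOWN refl])
      apply (rule wp_callI[OF JOIN refl])
      using u(1) apply simp
      done
  qed
qed

lemma coherent_proc_ok:
  "coherent T \<Longrightarrow> bags T \<subseteq> BB \<Longrightarrow> val_size (enc_bag_tree T) \<le> k \<Longrightarrow> proc_ok T"
proof (induction T)
  case (Node b ts)
  have sz: "val_size (enc_bag_tree (Node b ts)) =
      1 + val_size (enc_list (map enc_nat b)) + val_size (enc_list (map enc_bag_tree ts))"
    by simp
  have b: "length b \<le> k"
    using length_le_val_size[of "map enc_nat b"] sz Node.prems by simp
  have ok: "\<forall>t\<in>set ts. proc_ok t"
  proof
    fix t assume t: "t \<in> set ts"
    then have "val_size (enc_bag_tree t) \<le> k"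
      using val_size_mem[of "enc_bag_tree t" "map enc_bag_tree ts"] sz Node.prems by auto
    then show "proc_ok t"
      using Node t by (auto simp: list_all_iff)
  qed
  show ?case
    unfolding proc_ok_def
  proof (intro allI impI)
    fix L F Q
    let ?T = "Node b ts"
    assume ctx: "ctx L F Q" and root: "sl (verts ?T) \<inter> set L \<subseteq> sl (set (root_bag ?T))"
      and Q: "sl (verts ?T) \<inter> Q = {}"
    have L: "distinct L" "set L \<subseteq> set U"
      using ctx unfolding ctx_def by (auto simp: sl_def)
    have lenL: "length L \<le> k"
      using card_mono[OF finite_set L(2)] distinct_card[OF L(1)] distinct_card[OF distinct_U] length_U
      by simp
    have SLOTS: "runs SLOTS [enc_slots U, enc_list (map enc_nat b)] (enc_slots (slots_in (set b) U)) unit_cost"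
      using b length_U
      by (intro runs_mono[OF runs_SLOTS[OF size_U] order_trans[OF _ unit_cost_bounds(2)]]
          mult_le_mono add_le_mono mem_cost_mono) auto
    have len: "length (slots_in (set b) U) \<le> k"
      unfolding slots_in_def using length_U length_filter_le le_trans by blast
    have s: "\<forall>x\<in>set (slots_in (set b) U). val_size (enc_slot x) \<le> k"
      using size_U by (auto simp: slots_in_def)
    have OUTSIDE: "runs OUTSIDE [enc_slots (slots_in (set b) U), enc_slots L]
        (enc_slots (filter (\<lambda>x. x \<notin> set L) (slots_in (set b) U))) unit_cost"
      using len lenL
      by (intro runs_mono[OF runs_OUTSIDE_slots[OF s] order_trans[OF _ unit_cost_bounds(2)]]
          mult_le_mono add_le_mono mem_cost_mono) auto
    have PROCNEW: "runs PROCNEW [enc_bag_tree ?T, enc_es, enc_slots U, enc_slots L,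
        table L (\<lambda>D. opt F (D \<union> Q)), enc_slots (filter (\<lambda>x. x \<notin> set L) (slots_in (set b) U))]
      (table L (\<lambda>D. opt (F \<union> edges_of (bags ?T) (set L)) (D \<union> (Q \<union> (sl (verts ?T) - set L)))))
      (15 * unit_cost + 20 * unit_cost * val_size (enc_list (map enc_bag_tree ts)))"
      using root Q Node.prems b by (intro runs_PROCNEW[OF ctx ok refl]) auto
    have c: "20 * unit_cost + 20 * unit_cost * val_size (enc_list (map enc_bag_tree ts)) \<le> tree_cost ?T"
      unfolding sz by (simp add: algebra_simps)
    have T': "val_fst (enc_bag_tree ?T) = enc_list (map enc_nat b)"
      by simp
    show "runs PROC [enc_bag_tree ?T, enc_es, enc_slots U, enc_slots L, table L (\<lambda>D. opt F (D \<union> Q))]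
      (table L (\<lambda>D. opt (F \<union> edges_of (bags ?T) (set L)) (D \<union> (Q \<union> (sl (verts ?T) - set L)))))
      (tree_cost ?T)"
      apply (rule runsI)
       apply simp
      apply (simp add: PROC_body_def T' del: enc_bag_tree.simps)
      apply (rule wp_callI[OF SLOTS refl])
      apply (rule wp_callI[OF OUTSIDE refl])
      apply (rule wp_callI[OF PROCNEW refl])
      using c unit_cost_bounds(1) apply (simp del: enc_bag_tree.simps)
      done
  qed
qed

end


section \<open>From connected occurrence sets to the running intersection property\<close>

section \<open>Tree decompositions as rooted trees\<close>

lemma nodes_Node: "nodes (Node b ts) = insert [] {i # p |i p. i < length ts \<and> p \<in> nodes (ts ! i)}"
proof -
  have "p \<in> nodes (Node b ts) \<longleftrightarrow> p = [] \<or> (\<exists>i q. p = i # q \<and> i < length ts \<and> q \<in> nodes (ts ! i))" for p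
    by (cases p) (auto simp: nodes_def)
  then show ?thesis by auto
qed

lemma bag_Nil: "bag T [] = set (root_bag T)"
  by (simp add: bag_def bag_list_def)

lemma bag_Cons: "i < length ts \<Longrightarrow> bag (Node b ts) (i # p) = bag (ts ! i) p"
  by (simp add: bag_def bag_list_def)

lemma bags_eq: "bags T = bag T ` nodes T"
proof (induction T)
  case (Node b ts)
  have "\<Union>(bags ` set ts) = (\<Union>i<length ts. bags (ts ! i))"
    unfolding set_conv_nth by auto
  also have "\<dots> = (\<Union>i<length ts. bag (ts ! i) ` nodes (ts ! i))"
    using Node by auto
  also have "\<dots> = bag (Node b ts) ` {i # p |i p. i < length ts \<and> p \<in> nodes (ts ! i)}"
    by (force simp: bag_Cons)
  finally show ?case by (simp add: nodes_Node bag_Nil)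
qed

text \<open>The edge between \<open>p\<close> and \<open>p @ [i]\<close> is a separator: paths
  extending \<open>p @ [i]\<close> form its lower side, and \<open>r\<close> lies on the upper one.
  Prepending an index carries the property over to child subtrees.\<close>

definition separating :: "bag_tree \<Rightarrow> bool" where
  "separating T \<longleftrightarrow> (\<forall>p i q r v. p @ i # q \<in> nodes T \<longrightarrow> v \<in> bag T (p @ i # q) \<longrightarrow>
     r \<in> nodes T \<longrightarrow> v \<in> bag T r \<longrightarrow> (\<forall>q'. r \<noteq> p @ i # q') \<longrightarrow>
     v \<in> bag T (p @ [i]) \<and> v \<in> bag T p)"

text \<open>The only edge of the tree that leaves the subtree below \<open>p @ [i]\<close> ends in \<open>p\<close>.\<close>

lemma leaves_subtree:
  assumes "(x, y) \<in> {(a, b). a \<in> J \<and> b \<in> J \<and> {a, b} \<in> tree_edges T}\<^sup>*"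
    and "\<exists>q. x = p @ i # q" "\<forall>q. y \<noteq> p @ i # q"
  shows "p @ [i] \<in> J \<and> p \<in> J"
  using assms
proof (induction rule: converse_rtrancl_induct)
  case (step x x')
  show ?case
  proof (cases "\<exists>q. x' = p @ i # q")
    case True
    then show ?thesis using step by auto
  next
    case False
    from step obtain q where q: "x = p @ i # q" by auto
    from step obtain p' j where "{x, x'} = {p', p' @ [j]}"
      by (auto simp: tree_edges_def)
    then consider "x = p'" "x' = p' @ [j]" | "x = p' @ [j]" "x' = p'"
      by (auto simp: doubleton_eq_iff)
    then show ?thesis
    proof cases
      case 1
      then show ?thesis using q False by auto
    next
      case 2
      \<comment> \<open>This step goes up; with a nonempty \<open>q\<close> it would end below
        \<open>p @ [i]\<close> still.\<close>
      then have "q = []" using q False by (cases q rule: rev_cases) auto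
      then show ?thesis using 2 q step by auto
    qed
  qed
qed auto

lemma connected_separating:
  assumes "\<forall>v\<in>verts T. connected_on {p \<in> nodes T. v \<in> bag T p} (tree_edges T)"
  shows "separating T"
  unfolding separating_def
proof (intro allI impI)
  fix p i q r v
  assume "p @ i # q \<in> nodes T" "v \<in> bag T (p @ i # q)" "r \<in> nodes T" "v \<in> bag T r"
    and r: "\<forall>q'. r \<noteq> p @ i # q'"
  moreover from this have "v \<in> verts T" by (auto simp: verts_def bags_eq)
  ultimately have "(p @ i # q, r) \<in> {(a, b). a \<in> {p \<in> nodes T. v \<in> bag T p} \<and>
      b \<in> {p \<in> nodes T. v \<in> bag T p} \<and> {a, b} \<in> tree_edges T}\<^sup>*"
    using assms unfolding connected_on_def by blast
  from leaves_subtree[OF this _ r] show "v \<in> bag T (p @ [i]) \<and> v \<in> bag T p" by auto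
qed

text \<open>Both conditions are separation at the edge from the root to child \<open>i\<close>:
  against the root itself for the bag condition, against a node of another child for the sibling
  condition.\<close>

lemma separating_coherent: "separating T \<Longrightarrow> coherent T"
proof (induction T)
  case (Node b ts)
  let ?T = "Node b ts"
  have sep: "v \<in> bag ?T (p @ [i]) \<and> v \<in> bag ?T p"
    if "p @ i # q \<in> nodes ?T" "v \<in> bag ?T (p @ i # q)" "r \<in> nodes ?T" "v \<in> bag ?T r"
      "\<forall>q'. r \<noteq> p @ i # q'" for p i q r v
    using Node.prems that unfolding separating_def by blast
  have child: "separating (ts ! i)" if i: "i < length ts" for i
    unfolding separating_def
  proof (intro allI impI)
    fix p j q r v
    assume "p @ j # q \<in> nodes (ts ! i)" "v \<in> bag (ts ! i) (p @ j # q)"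
      "r \<in> nodes (ts ! i)" "v \<in> bag (ts ! i) r" "\<forall>q'. r \<noteq> p @ j # q'"
    then show "v \<in> bag (ts ! i) (p @ [j]) \<and> v \<in> bag (ts ! i) p"
      using sep[of "i # p" j q v "i # r"] i by (simp add: nodes_Node bag_Cons)
  qed
  have "coherent t" if "t \<in> set ts" for t
    using that Node.IH child by (auto simp: in_set_conv_nth)
  moreover have "verts t \<inter> set b \<subseteq> set (root_bag t)" if t: "t \<in> set ts" for t
  proof
    fix v assume v: "v \<in> verts t \<inter> set b"
    obtain i where i: "t = ts ! i" "i < length ts" using t by (auto simp: in_set_conv_nth)
    obtain q where "q \<in> nodes t" "v \<in> bag t q" using v by (auto simp: verts_def bags_eq)
    then show "v \<in> set (root_bag t)"
      using sep[of "[]" i q v "[]"] v i by (simp add: nodes_Node bag_Cons bag_Nil)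
  qed
  moreover have "sorted_wrt (\<lambda>s t. verts s \<inter> verts t \<subseteq> set b) ts"
    unfolding sorted_wrt_iff_nth_less
  proof (intro allI impI subsetI)
    fix i j v assume ij: "i < j" "j < length ts" and v: "v \<in> verts (ts ! i) \<inter> verts (ts ! j)"
    then obtain q q' where "q \<in> nodes (ts ! i)" "v \<in> bag (ts ! i) q"
      "q' \<in> nodes (ts ! j)" "v \<in> bag (ts ! j) q'"
      by (auto simp: verts_def bags_eq)
    then show "v \<in> set b"
      using sep[of "[]" i q v "j # q'"] ij by (simp add: nodes_Node bag_Cons bag_Nil)
  qed
  ultimately show ?case by (simp add: list_all_iff)
qed

section \<open>From the penalised optimum to minimum temporal edge covers, and the overall time
  bound\<close>

section \<open>Correctness and running time\<close>

lemma set_universe: "set (universe es L) = set L \<union> covered (set es)"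
  by (induction es arbitrary: L) auto

lemma distinct_universe:
  "distinct L \<Longrightarrow> \<forall>e\<in>set es. distinct (cov e) \<Longrightarrow> distinct (universe es L)"
proof (induction es arbitrary: L)
  case (Cons e es)
  have "distinct (filter (\<lambda>s. s \<notin> set L) (cov e) @ L)" using Cons.prems by auto
  with Cons show ?case by simp
qed simp

lemma length_universe_le: "length (universe es L) \<le> length L + 2 * val_size (enc_list (map enc_edge es))"
proof (induction es arbitrary: L)
  case (Cons e es)
  have "length (cov e) \<le> 2 * val_size (enc_edge e)"
    using length_le_val_size[of "map enc_nat (snd (snd e))"] by (cases e) (simp add: enc_edge_def cov.simps)
  then have "length (filter (\<lambda>s. s \<notin> set L) (cov e)) \<le> 2 * val_size (enc_edge e)"
    using length_filter_le le_trans by blast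
  then show ?case
    using Cons[of "filter (\<lambda>s. s \<notin> set L) (cov e) @ L"] by simp
qed simp

definition endpoints :: "edge \<Rightarrow> nat set" where
  "endpoints e = {fst e, fst (snd e)}"

lemma mem_cov_iff: "(v, t) \<in> set (cov e) \<longleftrightarrow> v \<in> endpoints e \<and> t \<in> set (snd (snd e))"
  by (cases e) (auto simp: endpoints_def cov.simps)

text \<open>In \<open>opt\<close> an uncovered slot costs as much as an edge, and every slot lies in some edge.\<close>

lemma opt_eq_min_temporal_edge_cover:
  assumes tg: "temporal_graph V E lam \<tau>"
    and inj: "inj_on endpoints (set es)" and E: "endpoints ` set es = E"
    and lam: "\<forall>e\<in>set es. set (snd (snd e)) = lam (endpoints e)"
  shows "opt (set es) (covered (set es)) = min_temporal_edge_cover V E lam \<tau>"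
proof -
  let ?U = "covered (set es)"
  have cov: "(v, t) \<in> set (cov e) \<longleftrightarrow> v \<in> endpoints e \<and> t \<in> lam (endpoints e)" if "e \<in> set es" for e v t
    using that lam by (simp add: mem_cov_iff)
  have slot: "(v, t) \<in> ?U \<longleftrightarrow> \<not> isolated E lam v t" for v t
  proof
    assume "(v, t) \<in> ?U"
    then obtain e where e: "e \<in> set es" "v \<in> endpoints e" "t \<in> lam (endpoints e)"
      by (auto simp: covered_def cov)
    then obtain u where "endpoints e = {u, v}" by (auto simp: endpoints_def)
    then show "\<not> isolated E lam v t" using e E by (auto simp: isolated_def)
  next
    assume "\<not> isolated E lam v t"
    then obtain u where "{u, v} \<in> E" "t \<in> lam {u, v}" by (auto simp: isolated_def)
    moreover from this obtain e where "e \<in> set es" "endpoints e = {u, v}" using E by auto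
    ultimately show "(v, t) \<in> ?U" by (auto simp: covered_def cov)
  qed
  have dom: "v \<in> V \<and> t \<in> {1..\<tau>}" if "(v, t) \<in> ?U" for v t
  proof -
    obtain e where e: "e \<in> set es" "v \<in> endpoints e" "t \<in> lam (endpoints e)"
      using \<open>(v, t) \<in> ?U\<close> by (auto simp: covered_def cov)
    then have "endpoints e \<in> E" using E by auto
    then have "endpoints e \<subseteq> V" "lam (endpoints e) \<subseteq> {1..\<tau>}"
      using tg unfolding temporal_graph_def simple_graph_def by auto
    with e show ?thesis by auto
  qed
  have cover_iff: "temporal_edge_cover V E lam \<tau> (endpoints ` S) \<longleftrightarrow> ?U \<subseteq> covered S"
    if S: "S \<subseteq> set es" for S
  proof -
    have "(\<exists>e\<in>endpoints ` S. v \<in> e \<and> t \<in> lam e) \<longleftrightarrow> (v, t) \<in> covered S" for v t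
      using cov[OF subsetD[OF S]] by (auto simp: covered_def)
    then have "temporal_edge_cover V E lam \<tau> (endpoints ` S) \<longleftrightarrow>
        (\<forall>v\<in>V. \<forall>t\<in>{1..\<tau>}. (v, t) \<in> ?U \<longrightarrow> (v, t) \<in> covered S)"
      using S E unfolding temporal_edge_cover_def slot by auto
    also have "\<dots> \<longleftrightarrow> ?U \<subseteq> covered S" using dom by auto
    finally show ?thesis .
  qed
  let ?P = "\<lambda>k. \<exists>S. temporal_edge_cover V E lam \<tau> S \<and> card S = k"
  show ?thesis
  proof (rule antisym)
    \<comment> \<open>All edges together form a cover, so the least size is attained.\<close>
    have "?P (card E)" using cover_iff[of "set es"] E by auto
    then have "?P (min_temporal_edge_cover V E lam \<tau>)"
      unfolding min_temporal_edge_cover_def by (rule LeastI)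
    then obtain C where C: "temporal_edge_cover V E lam \<tau> C" "card C = min_temporal_edge_cover V E lam \<tau>"
      by auto
    then have "C \<subseteq> endpoints ` set es" using E by (simp add: temporal_edge_cover_def)
    then obtain S where S: "S \<subseteq> set es" "C = endpoints ` S" by (auto simp: subset_image_iff)
    have "card C = card S" using S inj by (auto intro: card_image inj_on_subset)
    moreover have "?U - covered S = {}" using cover_iff[OF S(1)] C S by auto
    then have "card (?U - covered S) = 0" by (simp only: card.empty)
    ultimately show "opt (set es) ?U \<le> min_temporal_edge_cover V E lam \<tau>"
      using opt_le[of "set es" S ?U] S C by simp
  next
    obtain S where S: "S \<subseteq> set es" "opt (set es) ?U = card S + card (?U - covered S)"
      by (rule opt_attained[of "set es"]) auto
    \<comment> \<open>Each uncovered slot is repaired by an edge \<open>g s\<close> that covers it;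
      the repairs cost no more than the penalties they replace.\<close>
    have "\<forall>s\<in>?U - covered S. \<exists>e\<in>set es. s \<in> set (cov e)" by (auto simp: covered_def)
    then obtain g where g: "\<And>s. s \<in> ?U - covered S \<Longrightarrow> g s \<in> set es \<and> s \<in> set (cov (g s))"
      by metis
    let ?S = "S \<union> g ` (?U - covered S)"
    have fin: "finite ?U" "finite S" using S by (auto simp: covered_def dest: finite_subset)
    have "?U \<subseteq> covered ?S"
    proof
      fix s assume s: "s \<in> ?U"
      show "s \<in> covered ?S"
      proof (cases "s \<in> covered S")
        case False
        with s g[of s] have "s \<in> set (cov (g s))" "g s \<in> ?S" by blast+
        then show ?thesis unfolding covered_def by blast
      qed simp
    qed
    moreover have "?S \<subseteq> set es" using S g by auto
    ultimately have "?P (card (endpoints ` ?S))" using cover_iff by blast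
    then have "min_temporal_edge_cover V E lam \<tau> \<le> card (endpoints ` ?S)"
      unfolding min_temporal_edge_cover_def by (rule Least_le)
    also have "\<dots> \<le> card ?S" using fin by (intro card_image_le) auto
    also have "\<dots> \<le> card S + card (g ` (?U - covered S))" by (rule card_Un_le)
    also have "\<dots> \<le> card S + card (?U - covered S)" using fin by (intro add_left_mono card_image_le) auto
    finally show "min_temporal_edge_cover V E lam \<tau> \<le> opt (set es) ?U" using S by simp
  qed
qed

text \<open>The traversal starts outside the root with no slots. There the table is a single leaf,
  so \<open>Null\<close> serves both as the slot list and as the value 0, and \<open>PROC\<close>
  returns the optimum in unary.\<close>

lemma runs_MAIN:
  assumes x: "x = enc_instance vs es \<tau> T"
    and U: "runs UNIVERSE [enc_list (map enc_edge es), Null] (enc_slots U) a"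
    and P: "runs PROC [enc_bag_tree T, enc_list (map enc_edge es), enc_slots U, Null, Null] (un m) b"
  shows "runs MAIN [x] (enc_nat m) (a + b + 50 * (m + 1) * (m + 1) + 30)"
proof -
  have e: "(\<lambda>(u, v, ls). Cell (enc_nat u) (Cell (enc_nat v) (enc_list (map enc_nat ls)))) = enc_edge"
    by (auto simp: enc_edge_def)
  show ?thesis
    unfolding x enc_instance_def e
    apply (rule runsI)
     apply simp
    apply (simp add: MAIN_body_def)
    apply (rule wp_callI[OF U refl])
    apply (rule wp_callI[OF P refl])
    apply (rule wp_callI[OF runs_TOBIN refl])
    apply simp
    done
qed

lemma runs_computes_in:
  assumes "runs MAIN [x] y b"
  shows "\<exists>n. computes_in prog x y n \<and> n \<le> b + 2"
proof -
  have "wp (Call MAIN [Var 0]) [x] (\<lambda>v n. v = y \<and> n \<le> b + 2)"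
    apply simp
    apply (rule wp_callI[OF assms refl])
    apply simp
    done
  then show ?thesis
    by (auto simp: wp_def computes_in_def MAIN_def)
qed

text \<open>The fifth power comes from the traversal: \<open>mem_cost\<close> is quadratic, and
  three linear factors remain, one of them the size of the tree.\<close>

lemma total_cost_le:
  fixes k G c m :: nat
  assumes "1 \<le> k" "1 \<le> G" "m \<le> k" "c \<le> k"
  shows "(mem_cost k k + 200) * (k + 1) * (k + 1) +
      20 * ((mem_cost k k + 400) * (4 * k + 10) * (k + 1) * G) * c +
      50 * (m + 1) * (m + 1) + 32 \<le> 1000000 * k ^ 5 * G"
proof -
  have mem: "mem_cost k k + 400 \<le> 500 * k ^ 2"
  proof -
    have "mem_cost k k \<le> (50 * k) * (2 * k)"
      unfolding mem_cost_def using assms by (intro mult_le_mono) auto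
    moreover have "1 \<le> k * k" using assms by simp
    ultimately show ?thesis unfolding power2_eq_square by linarith
  qed
  have "(mem_cost k k + 200) * (k + 1) * (k + 1) \<le> (500 * k ^ 2) * (2 * k) * (2 * k)"
    using mem assms by (intro mult_le_mono) auto
  moreover have "20 * ((mem_cost k k + 400) * (4 * k + 10) * (k + 1) * G) * c
      \<le> 20 * ((500 * k ^ 2) * (14 * k) * (2 * k) * G) * k"
    using mem assms by (intro mult_le_mono) auto
  moreover have "50 * (m + 1) * (m + 1) \<le> 50 * (2 * k) * (2 * k)"
    using assms by (intro mult_le_mono) auto
  moreover have "k ^ 2 = k * k" "k ^ 4 = k * k * k * k" "k ^ 5 = k * k * k * k * k"
    by (simp_all add: eval_nat_numeral)
  then have "(500 * k ^ 2) * (2 * k) * (2 * k) = 2000 * k ^ 4"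
    "20 * ((500 * k ^ 2) * (14 * k) * (2 * k) * G) * k = 280000 * (k ^ 5 * G)"
    "50 * (2 * k) * (2 * k) = 200 * k ^ 2"
    by simp_all
  ultimately have "(mem_cost k k + 200) * (k + 1) * (k + 1) +
      20 * ((mem_cost k k + 400) * (4 * k + 10) * (k + 1) * G) * c +
      50 * (m + 1) * (m + 1) + 32 \<le> 2000 * k ^ 4 + 280000 * (k ^ 5 * G) + 200 * k ^ 2 + 32"
    by linarith
  also have "\<dots> \<le> 1000000 * k ^ 5 * G"
  proof -
    have "k ^ 4 \<le> k ^ 5" "k ^ 2 \<le> k ^ 5" "1 \<le> k ^ 5"
      using assms by (auto intro: power_increasing)
    moreover have "k ^ 5 \<le> k ^ 5 * G" using assms by simp
    ultimately show ?thesis by linarith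
  qed
  finally show ?thesis .
qed

lemma edge_entries:
  assumes tg: "temporal_graph V E lam \<tau>" and gl: "graph_listing vs es V E lam"
  shows "endpoints ` set es = E" "inj_on endpoints (set es)" "distinct es"
    and "\<And>e. e \<in> set es \<Longrightarrow> set (snd (snd e)) = lam (endpoints e)"
    and "\<And>e. e \<in> set es \<Longrightarrow> distinct (cov e) \<and> cov e \<noteq> []"
    and "\<And>v t. (v, t) \<in> covered (set es) \<Longrightarrow> t \<in> {1..\<tau>}"
proof -
  have f: "(\<lambda>(u, v, ls). {u, v}) = endpoints"
    by (auto simp: endpoints_def)
  have d: "distinct (map endpoints es)" and E: "endpoints ` set es = E"
    and l: "\<forall>(u, v, ls)\<in>set es. distinct ls \<and> set ls = lam {u, v}"
    using gl unfolding graph_listing_def f by auto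
  show "endpoints ` set es = E" by (rule E)
  show "inj_on endpoints (set es)" "distinct es"
    using d by (auto simp: distinct_map)
  show lam: "set (snd (snd e)) = lam (endpoints e)" if "e \<in> set es" for e
    using l that by (auto simp: endpoints_def)
  have e: "card (endpoints e) = 2" "lam (endpoints e) \<noteq> {}" "lam (endpoints e) \<subseteq> {1..\<tau>}"
    if "e \<in> set es" for e
    using tg E that unfolding temporal_graph_def simple_graph_def by auto
  show "distinct (cov e) \<and> cov e \<noteq> []" if "e \<in> set es" for e
  proof -
    obtain u v ls where uv: "e = (u, v, ls)" by (cases e)
    then show ?thesis
      using e[OF that] lam[OF that] l that
      by (auto simp: endpoints_def cov.simps distinct_map inj_on_def card_2_iff)
  qed
  show "t \<in> {1..\<tau>}" if vt: "(v, t) \<in> covered (set es)" for v t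
  proof -
    obtain e' where "e' \<in> set es" "(v, t) \<in> set (cov e')"
      using vt by (auto simp: covered_def)
    then show ?thesis using e(3)[of e'] lam[of e'] by (auto simp: mem_cov_iff)
  qed
qed

theorem theorem11:
  "\<exists>(P :: program) (q :: nat poly).
     \<forall>(V :: nat set) (E :: nat set set) (lam :: nat set \<Rightarrow> nat set) (\<tau> :: nat)
       (vs :: nat list) (es :: (nat \<times> nat \<times> nat list) list) (T :: bag_tree) (w :: nat).
       temporal_graph V E lam \<tau> \<longrightarrow>
       graph_listing vs es V E lam \<longrightarrow>
       (\<forall>p\<in>nodes T. distinct (bag_list T p)) \<longrightarrow>
       tree_decomposition V E (nodes T) (tree_edges T) (bag T) \<longrightarrow>
       w = width (nodes T) (bag T) \<longrightarrow>
       (\<exists>n. computes_in P (enc_instance vs es \<tau> T)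
              (enc_nat (min_temporal_edge_cover V E lam \<tau>)) n \<and>
            n \<le> 2 ^ (w\<^sup>2) * 8 ^ (w * \<tau>) * poly q (val_size (enc_instance vs es \<tau> T)))"
proof (rule exI[of _ prog], rule exI[of _ "monom 243000000 5"], intro allI impI)
  fix V :: "nat set" and E :: "nat set set" and lam :: "nat set \<Rightarrow> nat set" and \<tau> :: nat
    and vs :: "nat list" and es :: "(nat \<times> nat \<times> nat list) list" and T :: bag_tree and w :: nat
  assume tg: "temporal_graph V E lam \<tau>" and gl: "graph_listing vs es V E lam"
    and td: "tree_decomposition V E (nodes T) (tree_edges T) (bag T)"
    and w: "w = width (nodes T) (bag T)"
  let ?x = "enc_instance vs es \<tau> T"
  define N where "N = val_size ?x"
  \<comment> \<open>A slot consists of two codes and a cell, hence has size at most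
    \<open>2 * N + 1\<close>. The coefficient 243000000 is \<open>3 ^ 5\<close> times the constant
    of \<open>total_cost_le\<close>.\<close>
  define k where "k = 3 * N"
  define G :: nat where "G = 8 ^ (w * \<tau>)"
  define U where "U = universe es []"
  \<comment> \<open>The empty bag acts as the parent of the root.\<close>
  define BB where "BB = insert {} (bags T)"
  note edges = edge_entries[OF tg gl]
  have U: "set U = covered (set es)" "distinct U"
    unfolding U_def using edges(5) by (auto simp: set_universe intro!: distinct_universe)
  have e: "(\<lambda>(u, v, ls). Cell (enc_nat u) (Cell (enc_nat v) (enc_list (map enc_nat ls)))) = enc_edge"
    by (auto simp: enc_edge_def)
  have N: "val_size (enc_list (map enc_edge es)) \<le> N" "val_size (enc_bag_tree T) \<le> N" "1 \<le> N"
    unfolding N_def enc_instance_def e by auto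
  have edge_size: "val_size (enc_edge e) \<le> N" if "e \<in> set es" for e
    using val_size_mem[of "enc_edge e" "map enc_edge es"] that N by auto
  have slot_size: "val_size (enc_slot s) \<le> k" if e: "e \<in> set es" and s: "s \<in> set (cov e)" for e s
  proof -
    obtain u v ls where uv: "e = (u, v, ls)" by (cases e)
    have "fst s = u \<or> fst s = v" "snd s \<in> set ls" using s unfolding uv by (auto simp: cov.simps)
    then have "val_size (enc_nat (fst s)) \<le> N" "val_size (enc_nat (snd s)) \<le> N"
      using edge_size[OF e] val_size_mem[of "enc_nat (snd s)" "map enc_nat ls"]
      unfolding uv enc_edge_def by auto
    then show ?thesis using N unfolding k_def enc_slot_def by simp
  qed
  have length_cov: "length (cov e) \<le> k" if "e \<in> set es" for e
    using edge_size[OF that] length_le_val_size[of "map enc_nat (snd (snd e))"]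
    unfolding k_def by (cases e) (simp add: enc_edge_def cov.simps)
  have length_U: "length U \<le> k"
    using length_universe_le[of es "[]"] N unfolding U_def k_def by simp
  have fin: "finite (nodes T)" and VT: "verts T = V"
    using td unfolding tree_decomposition_def is_tree_def simple_graph_def
    by (auto simp: verts_def bags_eq)
  have card_bag: "card X \<le> w + 1" "finite X" if X: "X \<in> bags T" for X
  proof -
    obtain p where p: "p \<in> nodes T" "X = bag T p" using X by (auto simp: bags_eq)
    then have "card X \<le> Max ((\<lambda>i. card (bag T i)) ` nodes T)" using fin by (intro Max_ge) auto
    then show "card X \<le> w + 1" unfolding w width_def by simp
    show "finite X" using p by (simp add: bag_def)
  qed
  have edge_bag: "\<exists>X\<in>bags T. endpoints e \<subseteq> X" if "e \<in> set es" for e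
    using td edges(1) that unfolding tree_decomposition_def by (auto simp: bags_eq)
  have card_slots: "card (set (slots_in X U)) \<le> card X * \<tau>" if "finite X" for X
  proof -
    have "set (slots_in X U) \<subseteq> X \<times> {1..\<tau>}"
      using edges(6) U by (auto simp: slots_in_def)
    then have "card (set (slots_in X U)) \<le> card (X \<times> {1..\<tau>})" using that by (intro card_mono) auto
    then show ?thesis by (simp add: card_cartesian_product)
  qed
  \<comment> \<open>The case in which \<open>2 * w + 1 \<le> 3 * w\<close> fails; bags with at most
    one vertex contain no edge.\<close>
  have w0: "U = []" if "w = 0"
  proof -
    have "e \<notin> set es" for e
    proof
      assume e: "e \<in> set es"
      then obtain X where X: "X \<in> bags T" "endpoints e \<subseteq> X" using edge_bag by blast
      have "card (endpoints e) = 2"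
        using e edges(1) tg unfolding temporal_graph_def simple_graph_def by auto
      with X card_bag[OF X(1)] card_mono[of X "endpoints e"] that show False by simp
    qed
    then have "es = []" by (cases es) auto
    then show ?thesis by (simp add: U_def)
  qed
  have finite_BB: "finite X" "card X \<le> w + 1" if "X \<in> BB" for X
    using that card_bag unfolding BB_def by auto
  have pow_G: "2 ^ n \<le> G" if "n \<le> 3 * (w * \<tau>)" for n
  proof -
    have "(2::nat) ^ n \<le> 2 ^ (3 * (w * \<tau>))" using that by (intro power_increasing) auto
    then show ?thesis unfolding G_def by (simp add: power_mult)
  qed
  interpret instance_bounds es U k G BB
  proof
    show "\<forall>e\<in>set es. length (cov e) \<le> k \<and> set (cov e) \<subseteq> set U"
      using length_cov U by (auto simp: covered_def)
    show "length es \<le> k"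
      using length_le_val_size[of "map enc_edge es"] N unfolding k_def by simp
    show "\<forall>x\<in>set U. val_size (enc_slot x) \<le> k"
      using slot_size unfolding U covered_def by auto
    show "2 ^ card (set (slots_in X U)) \<le> G" if X: "X \<in> BB" for X
    proof (cases "w = 0")
      case True
      then show ?thesis using w0 by (simp add: slots_in_def G_def)
    next
      case False
      have "card (set (slots_in X U)) \<le> (w + 1) * \<tau>"
        using card_slots[of X] finite_BB[OF X] by (meson le_trans mult_le_mono1)
      also have "\<dots> \<le> (3 * w) * \<tau>" using False by (intro mult_le_mono1) auto
      finally show ?thesis by (intro pow_G) simp
    qed
    show "2 ^ (card (set (slots_in Y U)) + card (set (slots_in X U) \<inter> set (slots_in Y U))) \<le> G"
      if X: "X \<in> BB" and Y: "Y \<in> BB" and XY: "\<not> set (slots_in X U) \<subseteq> set (slots_in Y U)" for X Y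
    proof -
      have "w \<noteq> 0" using XY w0 by (auto simp: slots_in_def)
      have "\<not> X \<subseteq> Y" using XY by (auto simp: slots_in_def)
      \<comment> \<open>This is the gain from skipping: the common part misses a vertex of
        \<open>X\<close>, so it has at most \<open>w\<close> vertices.\<close>
      then have "card (X \<inter> Y) < card X" using finite_BB[OF X] by (intro psubset_card_mono) auto
      then have XYw: "card (X \<inter> Y) \<le> w" using finite_BB[OF X] by simp
      have "set (slots_in X U) \<inter> set (slots_in Y U) = set (slots_in (X \<inter> Y) U)"
        by (auto simp: slots_in_def)
      then have "card (set (slots_in X U) \<inter> set (slots_in Y U)) \<le> w * \<tau>"
        using card_slots[of "X \<inter> Y"] finite_BB[OF X] XYw by (simp add: le_trans[OF _ mult_le_mono1])
      moreover have "card (set (slots_in Y U)) \<le> (w + 1) * \<tau>"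
        using card_slots[of Y] finite_BB[OF Y] by (meson le_trans mult_le_mono1)
      moreover have "(w + 1) * \<tau> + w * \<tau> \<le> (3 * w) * \<tau>"
        unfolding add_mult_distrib[symmetric] using \<open>w \<noteq> 0\<close> by (intro mult_le_mono1) auto
      ultimately have "card (set (slots_in Y U)) + card (set (slots_in X U) \<inter> set (slots_in Y U))
          \<le> (3 * w) * \<tau>" by linarith
      then show ?thesis by (intro pow_G) simp
    qed
  qed (use U(2) edges(3) length_U in \<open>simp_all add: G_def\<close>)
  have coh: "coherent T"
    using td unfolding tree_decomposition_def VT[symmetric]
    by (intro separating_coherent connected_separating) auto
  have ok: "proc_ok T"
    by (rule coherent_proc_ok[OF coh]) (use N in \<open>auto simp: BB_def k_def\<close>)
  have ctx: "ctx [] {} {}"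
    unfolding ctx_def by (auto simp: BB_def sl_def)
  have P: "runs PROC [enc_bag_tree T, enc_list (map enc_edge es), enc_slots U, Null, Null]
      (un (opt (edges_of (bags T) {}) (sl (verts T)))) (tree_cost T)"
    using proc_okD[OF ok ctx]
    by (simp only: enc_slots_simps table.simps un_simps(1) list.set opt_empty Un_empty_left
        Un_empty_right card.empty Diff_empty Int_empty_right empty_subsetI refl simp_thms)
  have "edges_of (bags T) {} = set es"
  proof -
    have "\<exists>X\<in>bags T. set (cov e) \<subseteq> sl X" if e: "e \<in> set es" for e
    proof -
      obtain X where X: "X \<in> bags T" "endpoints e \<subseteq> X" using edge_bag[OF e] by blast
      have "(v, t) \<in> sl X" if vt: "(v, t) \<in> set (cov e)" for v t
      proof -
        have "(v, t) \<in> set U" using vt cov_es e by blast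
        moreover have "v \<in> X" using vt X unfolding mem_cov_iff by blast
        ultimately show ?thesis by (simp add: sl_def)
      qed
      with X show ?thesis by (meson subrelI)
    qed
    moreover have "\<not> set (cov e) \<subseteq> {}" if "e \<in> set es" for e
      using edges(5)[OF that] by simp
    ultimately show ?thesis unfolding edges_of_def by blast
  qed
  moreover have "sl (verts T) = covered (set es)"
  proof -
    have "v \<in> verts T" if vt: "(v, t) \<in> set U" for v t
    proof -
      obtain e where e: "e \<in> set es" "(v, t) \<in> set (cov e)" using vt U(1) unfolding covered_def by blast
      obtain X where "X \<in> bags T" "endpoints e \<subseteq> X" using edge_bag[OF e(1)] by blast
      then show ?thesis using e(2) unfolding mem_cov_iff verts_def by blast
    qed
    then show ?thesis unfolding U(1)[symmetric] by (auto simp: sl_def)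
  qed
  ultimately have opt: "opt (edges_of (bags T) {}) (sl (verts T)) = min_temporal_edge_cover V E lam \<tau>"
    using opt_eq_min_temporal_edge_cover[OF tg edges(2,1)] edges(4) by simp
  have UNIV: "runs UNIVERSE [enc_list (map enc_edge es), Null] (enc_slots U)
      ((mem_cost k k + 200) * (k + 1) * (length es + 1))"
    using runs_UNIVERSE[of es "[]" k] length_U length_cov slot_size by (simp add: U_def)
  obtain n where n: "computes_in prog ?x (enc_nat (min_temporal_edge_cover V E lam \<tau>)) n"
    "n \<le> (mem_cost k k + 200) * (k + 1) * (length es + 1) + tree_cost T +
      50 * (min_temporal_edge_cover V E lam \<tau> + 1) * (min_temporal_edge_cover V E lam \<tau> + 1) + 32"
    using runs_computes_in[OF runs_MAIN[OF refl UNIV P[unfolded opt]]] by auto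
  have "opt (set es) (set U) \<le> card (set U)" by (rule opt_le_card) simp
  then have min_le: "min_temporal_edge_cover V E lam \<tau> \<le> k"
    using opt_eq_min_temporal_edge_cover[OF tg edges(2,1)] edges(4) U(1) distinct_card[OF U(2)] length_U
    by simp
  have "n \<le> (mem_cost k k + 200) * (k + 1) * (k + 1) +
      20 * ((mem_cost k k + 400) * (4 * k + 10) * (k + 1) * G) * val_size (enc_bag_tree T) +
      50 * (min_temporal_edge_cover V E lam \<tau> + 1) * (min_temporal_edge_cover V E lam \<tau> + 1) + 32"
    by (rule order_trans[OF n(2)], unfold unit_cost_def, intro add_le_mono order_refl mult_le_mono)
      (rule length_es)
  also have "\<dots> \<le> 1000000 * k ^ 5 * G"
    by (rule total_cost_le) (use N(2,3) G min_le in \<open>simp_all add: k_def\<close>)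
  also have "\<dots> = G * poly (monom 243000000 5) N"
    by (simp add: k_def poly_monom power_mult_distrib)
  also have "\<dots> \<le> 2 ^ (w\<^sup>2) * G * poly (monom 243000000 5) N"
    by (intro mult_le_mono1) simp
  finally show "\<exists>n. computes_in prog ?x (enc_nat (min_temporal_edge_cover V E lam \<tau>)) n \<and>
      n \<le> 2 ^ (w\<^sup>2) * 8 ^ (w * \<tau>) * poly (monom 243000000 5) (val_size ?x)"
    using n(1) unfolding G_def N_def by blast
qed

end
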